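(* Let $f$ be a nonpolynomial entire function on $\mathbb C^n$. Then its graph $\Gamma_f\subset\mathbb C^{n+1}$ admits the Bernstein type inequality of an exponent $\mu:\mathbb Z_+\to\mathbb R_+$ such that $$1+\frac1n\le\liminf_{k\to\infty}\frac{\ln\mu(k)}{\ln k}\le 2.$$
   Context: $\mathbb Z_+=\{0,1,2,\dots\}$, $\mathbb R_+=[0,\infty)$; $\|\cdot\|$ is the Euclidean norm. The graph $\Gamma_f=\{(z,f(z)):z\in\mathbb C^n\}\subset\mathbb C^{n+m}$ of a holomorphic map $f:\mathbb C^n\to\mathbb C^m$ admits the Bernstein type inequality of exponent $\mu:\mathbb Z_+\to\mathbb R_+$ if for each $r>0$ there is a nonnegative constant $C(r)$ such that for all holomorphic polynomials $p$ on $\mathbb C^{n+m}$ $$\max_{\|z\|\le er}|p(z,f(z))|\le C(r)^{\mu(\deg p)}\max_{\|z\|\le r}|p(z,f(z))|.$$ *)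

theory Defs
  imports "HOL-Analysis.Analysis" "HOL-Library.Poly_Mapping"
begin

text \<open>Polynomials in the variables indexed by the finite type \<open>'v\<close> are finitely supported maps
  from multi-indices \<open>'v \<Rightarrow>\<^sub>0 nat\<close> to coefficients.\<close>

type_synonym 'v cpoly = "('v \<Rightarrow>\<^sub>0 nat) \<Rightarrow>\<^sub>0 complex"

definition cpoly_eval :: "'v::finite cpoly \<Rightarrow> complex ^ 'v \<Rightarrow> complex" where
  "cpoly_eval p x =
     (\<Sum>m\<in>Poly_Mapping.keys p.
        Poly_Mapping.lookup p m * (\<Prod>i\<in>UNIV. (x $ i) ^ Poly_Mapping.lookup m i))"

text \<open>The total degree; the zero polynomial gets degree 0.\<close>

definition cpoly_degree :: "'v::finite cpoly \<Rightarrow> nat" where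
  "cpoly_degree p =
     Max (insert 0 ((\<lambda>m. \<Sum>i\<in>UNIV. Poly_Mapping.lookup m i) ` Poly_Mapping.keys p))"

definition polynomial_fun :: "(complex ^ 'n \<Rightarrow> complex) \<Rightarrow> bool" where
  "polynomial_fun f \<longleftrightarrow> (\<exists>p :: 'n cpoly. \<forall>z. f z = cpoly_eval p z)"

text \<open>\<open>has_derivative\<close> only asks for a real-linear derivative, so complex homogeneity is
  required in addition.\<close>

definition entire :: "(complex ^ 'n \<Rightarrow> complex) \<Rightarrow> bool" where
  "entire f \<longleftrightarrow>
     (\<forall>z. \<exists>D. (f has_derivative D) (at z) \<and> (\<forall>c v. D (c *s v) = c * D v))"

text \<open>The point \<open>(z, f z)\<close> of the graph, with the coordinates of \<open>\<complex>\<^sup>n\<^sup>+\<^sup>m\<close> indexed by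
  the disjoint sum \<open>'n + 'm\<close>.\<close>

definition graph_point ::
    "(complex ^ 'n \<Rightarrow> complex ^ 'm) \<Rightarrow> complex ^ 'n \<Rightarrow> complex ^ ('n + 'm)" where
  "graph_point f z = (\<chi> i. case i of Inl a \<Rightarrow> z $ a | Inr b \<Rightarrow> f z $ b)"

text \<open>Maximum modulus of \<open>p(z, f z)\<close> on the closed Euclidean ball of radius \<open>r\<close>. For continuous
  \<open>f\<close> and \<open>r \<ge> 0\<close> the supremum is finite and attained.\<close>

definition graph_max ::
    "(complex ^ 'n \<Rightarrow> complex ^ 'm) \<Rightarrow> ('n + 'm) cpoly \<Rightarrow> real \<Rightarrow> real" where
  "graph_max f p r = (SUP z\<in>cball 0 r. cmod (cpoly_eval p (graph_point f z)))"

text \<open>The value \<open>0 powr 0 = 0\<close> (instead of 1) is harmless: under either convention \<open>C = 0\<close>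
  violates the inequality, already for \<open>p\<close> a coordinate of \<open>z\<close> or \<open>p = 1\<close>.\<close>

definition admits_bernstein ::
    "(complex ^ 'n \<Rightarrow> complex ^ 'm) \<Rightarrow> (nat \<Rightarrow> real) \<Rightarrow> bool" where
  "admits_bernstein f \<mu> \<longleftrightarrow>
     (\<forall>r>0. \<exists>C\<ge>0. \<forall>p :: ('n + 'm) cpoly.
        graph_max f p (exp 1 * r) \<le> C powr \<mu> (cpoly_degree p) * graph_max f p r)"

end

theory Submission
  imports Defs "HOL-Complex_Analysis.Complex_Analysis" "HOL-Real_Asymp.Real_Asymp"
begin

text \<open>Since \<open>\<mu> k \<ge> k\<^sup>2\<close> may be imposed, the point is to bound the doubling constant for degree \<open>k\<close> by
  \<open>exp (k\<^sup>2\<^sup>+\<^sup>\<delta>)\<close> for infinitely many \<open>k\<close>. By the maximum principle on annuli, a bound for the growth of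
  \<open>P z = p (z, f z)\<close> between two large spheres passes to all smaller ones, so one may work at a scale
  where the growth \<open>G\<close> of \<open>ln |f|\<close> is large and regular.

  There, let \<open>f = \<rho> w\<close> have more than \<open>k\<close> solutions on a disc in a complex line. The restriction of
  \<open>p (\<cdot>, \<rho> w)\<close> to that line interpolates \<open>P\<close> at these points, so it is bounded by \<open>e\<^sup>O\<^sup>(\<^sup>k\<^sup>) max |P|\<close>.
  A quantitative Picard theorem provides enough such \<open>w\<close>, for enough lines close to a direction in
  which \<open>f\<close> is large. Interpolating the polynomial \<open>p\<close> first in \<open>w\<close> and then in the direction of the
  line bounds \<open>p (z, w)\<close> everywhere, in particular for \<open>w = f z\<close> on a larger sphere.\<close>

section \<open>Holomorphic functions of one variable\<close>

text \<open>The exponent 2 is a balance of two costs. Let \<open>G\<close> and \<open>L\<close> be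
  the increments of the logarithm of the maximum modulus of \<open>f\<close> over steps
  \<open>d\<close> and \<open>6 * d\<close> of the logarithmic radius. More than \<open>k\<close>
  solutions on a line are obtained only if \<open>G\<close> beats \<open>k / d\<close>; carrying the
  bound of \<open>P\<close> from one sphere to the next costs a factor of about
  \<open>exp (k * (L + k * ln k))\<close>. Under regular growth, \<open>1 / d\<close> at most a
  small power of \<open>G\<close> and \<open>L\<close> at most a power of \<open>G\<close> slightly
  above 1, the degree \<open>k\<close> can be taken just below \<open>G\<close>, so both terms of
  the cost are close to \<open>k ^ 2\<close>. Such growth is only found at some scales. Hence good
  bounds hold only for a sequence of degrees, which is all that a liminf sees; other degrees borrow
  the bound of a larger degree. The obstacle in counting solutions is the exceptional value of
  Picard's theorem. It cannot be excluded for a given \<open>w\<close>, and its price is of order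
  \<open>L / d\<^sup>2\<close>, which exceeds \<open>G\<close>. Testing \<open>N\<close> separated
  values at once pays this price only once and divides it by \<open>N\<close>.\<close>

lemma norm_diff_less_norm_add_cnj:
  assumes "Re x > 0" "Re c > 0"
  shows "cmod (x - c) < cmod (x + cnj c)"
proof -
  have "(Re x - Re c)\<^sup>2 < (Re x + Re c)\<^sup>2"
    using assms by (simp add: power2_eq_square algebra_simps)
  then have "(cmod (x - c))\<^sup>2 < (cmod (x + cnj c))\<^sup>2"
    by (simp add: cmod_power2)
  then show ?thesis
    by (rule power2_less_imp_less) simp
qed

text \<open>The Cayley transform \<open>\<zeta>\<close> sends the right half-plane to the unit disc
  and the value at 0 to 0, so the Schwarz lemma applies; solving its bound for the real part gives
  Harnack's constant.\<close>

lemma harnack_Re_pos: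
  fixes \<psi> :: "complex \<Rightarrow> complex"
  assumes hol: "\<psi> holomorphic_on ball 0 r" and r: "r > 0"
    and pos: "\<And>z. cmod z < r \<Longrightarrow> Re (\<psi> z) > 0"
    and a: "cmod a < r"
  shows "Re (\<psi> a) \<le> (r + cmod a) / (r - cmod a) * Re (\<psi> 0)"
proof -
  define c where "c = \<psi> 0"
  have c: "Re c > 0" using pos[of 0] r by (simp add: c_def)
  define \<zeta> where "\<zeta> = (\<lambda>w. (\<psi> (of_real r * w) - c) / (\<psi> (of_real r * w) + cnj c))"
  have inb: "cmod (of_real r * w) < r" if "cmod w < 1" for w
    using that r by (simp add: norm_mult)
  have nz: "\<psi> (of_real r * w) + cnj c \<noteq> 0" if "cmod w < 1" for w
  proof -
    have "Re (\<psi> (of_real r * w) + cnj c) > 0"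
      using pos[OF inb[OF that]] c by simp
    then show ?thesis by force
  qed
  have "(\<psi> \<circ> (\<lambda>w. of_real r * w)) holomorphic_on ball 0 1"
    by (rule holomorphic_on_compose_gen[OF _ hol]) (use inb in \<open>auto intro!: holomorphic_intros\<close>)
  then have hol': "(\<lambda>w. \<psi> (of_real r * w)) holomorphic_on ball 0 1"
    by (simp add: o_def)
  have "\<zeta> holomorphic_on ball 0 1"
    unfolding \<zeta>_def by (intro holomorphic_intros hol') (use nz in auto)
  moreover have "\<zeta> 0 = 0" by (simp add: \<zeta>_def c_def)
  moreover have "cmod (\<zeta> w) < 1" if "cmod w < 1" for w
    using norm_diff_less_norm_add_cnj[OF pos[OF inb[OF that]] c] nz[OF that]
    by (simp add: \<zeta>_def norm_divide)
  moreover have a1: "cmod (a / of_real r) < 1"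
    using a r by (simp add: norm_divide)
  ultimately have *: "cmod (\<zeta> (a / of_real r)) \<le> cmod (a / of_real r)"
    by (rule Schwarz_Lemma(1))
  define t where "t = cmod a / r"
  have t: "0 \<le> t" "t < 1" using a r by (auto simp: t_def)
  define x where "x = \<psi> a"
  \<comment> \<open>Used with \<open>q\<close> the squared imaginary part, which
    \<open>x - c\<close> and \<open>x + cnj c\<close> share, and with \<open>T\<close> the square of
    \<open>t\<close>: it can be cancelled because \<open>t < 1\<close>.\<close>
  have gen: "p \<le> T * s" if "p + q \<le> T * (s + q)" "T * q \<le> 1 * q" for p q s T :: real
    using that by (simp add: algebra_simps)
  have x: "Re x > 0" using pos a by (simp add: x_def)
  have "cmod (x - c) / cmod (x + cnj c) \<le> t"
    using * r by (simp add: \<zeta>_def x_def t_def norm_divide)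
  moreover have "cmod (x + cnj c) > 0"
    using nz[OF a1] r by (simp add: x_def)
  ultimately have "cmod (x - c) \<le> t * cmod (x + cnj c)"
    by (simp add: field_simps)
  then have "(cmod (x - c))\<^sup>2 \<le> (t * cmod (x + cnj c))\<^sup>2"
    by (intro power_mono) auto
  then have "(Re x - Re c)\<^sup>2 + (Im x - Im c)\<^sup>2 \<le> t\<^sup>2 * ((Re x + Re c)\<^sup>2 + (Im x - Im c)\<^sup>2)"
    by (simp add: cmod_power2 power_mult_distrib)
  moreover have "t\<^sup>2 * (Im x - Im c)\<^sup>2 \<le> 1 * (Im x - Im c)\<^sup>2"
    using t by (intro mult_right_mono) (auto simp: power_le_one)
  ultimately have "(Re x - Re c)\<^sup>2 \<le> (t * (Re x + Re c))\<^sup>2"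
    unfolding power_mult_distrib by (rule gen)
  then have "\<bar>Re x - Re c\<bar> \<le> t * (Re x + Re c)"
    using t x c by (metis abs_le_square_iff abs_of_nonneg add_nonneg_nonneg less_imp_le mult_nonneg_nonneg)
  then have "Re x * (1 - t) \<le> (1 + t) * Re c"
    by (simp add: algebra_simps abs_le_iff)
  then have "r * (Re x * (1 - t)) \<le> r * ((1 + t) * Re c)"
    using r by (intro mult_left_mono) auto
  moreover have "cmod a = r * t" using r by (simp add: t_def)
  ultimately have "Re x * (r - cmod a) \<le> (r + cmod a) * Re c"
    by (simp add: algebra_simps)
  then show ?thesis
    using a by (simp add: x_def c_def field_simps)
qed

text \<open>A zero-free function on a disc has a holomorphic logarithm \<open>g\<close>, and
  \<open>ln A - g\<close> has nonnegative real part.\<close>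

lemma harnack_zero_free:
  fixes G :: "complex \<Rightarrow> complex"
  assumes hol: "G holomorphic_on ball 0 r" and r: "r > 0"
    and nz: "\<And>z. cmod z < r \<Longrightarrow> G z \<noteq> 0"
    and le: "\<And>z. cmod z < r \<Longrightarrow> cmod (G z) \<le> A"
    and a: "cmod a < r"
  shows "ln (A / cmod (G a)) \<le> (r + cmod a) / (r - cmod a) * ln (A / cmod (G 0))"
proof -
  obtain g where g: "g holomorphic_on ball 0 r" "\<And>z. z \<in> ball 0 r \<Longrightarrow> exp (g z) = G z"
    using holomorphic_logarithm_exists[OF convex_ball open_ball hol, of 0] nz r by auto
  have A: "A > 0" using nz[of 0] le[of 0] r by (smt (verit) norm_zero zero_less_norm_iff)
  have Re_g: "ln (A / cmod (G z)) = ln A - Re (g z)" if "cmod z < r" for z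
  proof -
    have "cmod (G z) = exp (Re (g z))" using g(2)[of z] that by (metis mem_ball_0 norm_exp_eq_Re)
    then show ?thesis using A by (simp add: ln_div)
  qed
  define C where "C = (r + cmod a) / (r - cmod a)"
  have C: "C > 0" using a r by (simp add: C_def add_pos_nonneg)
  \<comment> \<open>The half-plane version wants strict positivity; the slack \<open>e / C\<close>
    supplies it and is removed at the end by letting \<open>e\<close> tend to 0.\<close>
  have key: "ln (A / cmod (G a)) \<le> C * ln (A / cmod (G 0)) + e" if e: "e > 0" for e
  proof -
    define \<psi> where "\<psi> = (\<lambda>z. of_real (ln A + e / C) - g z)"
    have "\<psi> holomorphic_on ball 0 r" unfolding \<psi>_def by (intro holomorphic_intros g)
    moreover have "Re (\<psi> z) > 0" if z: "cmod z < r" for z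
    proof -
      have "ln (A / cmod (G z)) \<ge> 0" using le[OF z] nz[OF z] A by simp
      moreover have "e / C > 0" using e C by simp
      ultimately show ?thesis using Re_g[OF z] by (simp add: \<psi>_def)
    qed
    ultimately have "Re (\<psi> a) \<le> C * Re (\<psi> 0)"
      unfolding C_def using r a by (intro harnack_Re_pos) auto
    then have "ln A + e / C - Re (g a) \<le> C * (ln A - Re (g 0)) + C * (e / C)"
      by (simp add: \<psi>_def algebra_simps)
    moreover have "C * (e / C) = e" "e / C > 0" using C e by simp_all
    ultimately show ?thesis using Re_g[OF a] Re_g[of 0] r by simp
  qed
  then show ?thesis unfolding C_def[symmetric]
    by (rule field_le_epsilon)
qed

section \<open>Splitting off zeros, and interpolation at points of a disc\<close>

lemma holomorphic_divide_root:
  assumes "F holomorphic_on S" "open S" "z0 \<in> S" "F z0 = 0"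
  obtains G where "G holomorphic_on S" "\<And>z. z \<in> S \<Longrightarrow> F z = (z - z0) * G z"
proof
  show "(\<lambda>z. if z = z0 then deriv F z0 else (F z - F z0) / (z - z0)) holomorphic_on S"
    by (intro pole_lemma_open assms)
qed (use assms in auto)

text \<open>Zeros in \<open>U\<close> are divided out one at a time until \<open>m\<close> of them
  are collected or none is left. Stopping at \<open>m\<close> makes the statement meaningful for
  \<open>F = 0\<close> and for infinitely many zeros as well.\<close>

lemma divide_roots_dichotomy:
  assumes "F holomorphic_on S" "open S" "U \<subseteq> S"
  shows "\<exists>zs G. set zs \<subseteq> U \<and> length zs \<le> m \<and> G holomorphic_on S \<and>
           (\<forall>z\<in>S. F z = (\<Prod>x\<leftarrow>zs. z - x) * G z) \<and>
           (length zs = m \<or> (\<forall>z\<in>U. G z \<noteq> 0))"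
proof (induction m)
  case 0
  show ?case by (rule exI[of _ "[]"]) (use assms in auto)
next
  case (Suc m)
  then obtain zs G where *: "set zs \<subseteq> U" "length zs \<le> m" "G holomorphic_on S"
    "\<forall>z\<in>S. F z = (\<Prod>x\<leftarrow>zs. z - x) * G z" "length zs = m \<or> (\<forall>z\<in>U. G z \<noteq> 0)"
    by blast
  show ?case
  proof (cases "\<forall>z\<in>U. G z \<noteq> 0")
    case True
    then show ?thesis using * by (intro exI[of _ zs] exI[of _ G]) auto
  next
    case False
    then obtain z0 where z0: "z0 \<in> U" "G z0 = 0" by blast
    then obtain H where "H holomorphic_on S" "\<And>z. z \<in> S \<Longrightarrow> G z = (z - z0) * H z"
      using holomorphic_divide_root[OF *(3) assms(2), of z0] assms(3) by blast
    then show ?thesis using * z0 False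
      by (intro exI[of _ "z0 # zs"] exI[of _ H]) auto
  qed
qed

text \<open>Newton interpolation: \<open>\<pi>\<close> is the Newton interpolant of \<open>P\<close> at \<open>zs\<close>, and each divided
  difference costs a factor at most \<open>2 / (R' - 1)\<close> by the maximum principle.\<close>

lemma newton_interpolant_bound:
  fixes P H :: "complex \<Rightarrow> complex"
  assumes "zs \<noteq> []" "set zs \<subseteq> cball 0 1" "degree \<pi> < length zs"
    and "1 < R'" "R' < R" "P holomorphic_on ball 0 R" "H holomorphic_on ball 0 R"
    and "\<And>z. cmod z < R \<Longrightarrow> P z = poly \<pi> z + (\<Prod>x\<leftarrow>zs. z - x) * H z"
    and "\<And>z. cmod z \<le> R' \<Longrightarrow> cmod (P z) \<le> S"
    and "cmod x \<le> 1"
  shows "cmod (poly \<pi> x) \<le> (1 + 4 / (R' - 1)) ^ (length zs - 1) * S"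
  using assms
proof (induction zs arbitrary: \<pi> P S)
  case Nil
  then show ?case by simp
next
  case (Cons z0 zs)
  have R': "R' > 1" "R' < R" by fact+
  have z0: "cmod z0 \<le> 1" using Cons.prems by auto
  have Pz0: "P z0 = poly \<pi> z0" using Cons.prems(8)[of z0] z0 R' by simp
  have Sz0: "cmod (poly \<pi> z0) \<le> S" using Cons.prems(9)[of z0] z0 R' Pz0 by simp
  have S: "S \<ge> 0" using Sz0 norm_ge_zero order_trans by blast
  show ?case
  proof (cases "zs = []")
    case True
    then have "degree \<pi> = 0" using Cons.prems by simp
    then obtain c where "\<pi> = [:c:]" by (rule degree_eq_zeroE)
    then show ?thesis using Sz0 True by simp
  next
    case False
    define \<pi>1 where "\<pi>1 = synthetic_div \<pi> z0"
    \<comment> \<open>The divided difference of \<open>P\<close> at \<open>z0\<close>. It has the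
      same form as \<open>P\<close>, with the same \<open>H\<close> and one node fewer, which is
      what lets the induction run.\<close>
    define P1 where "P1 = (\<lambda>z. poly \<pi>1 z + (\<Prod>x\<leftarrow>zs. z - x) * H z)"
    have \<pi>: "poly \<pi> z = poly \<pi> z0 + (z - z0) * poly \<pi>1 z" for z
      using arg_cong[OF synthetic_div_correct'[of z0 \<pi>], of "\<lambda>p. poly p z"]
      by (simp add: \<pi>1_def algebra_simps)
    have P: "P z = P z0 + (z - z0) * P1 z" if "cmod z < R" for z
      using Cons.prems(8)[OF that] \<pi>[of z] Pz0 by (simp add: P1_def algebra_simps)
    have hol1: "P1 holomorphic_on ball 0 R"
    proof -
      have "(\<lambda>z. \<Prod>x\<leftarrow>zs. z - x) holomorphic_on ball 0 R"
        by (induction zs) (auto intro!: holomorphic_intros)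
      then show ?thesis unfolding P1_def
        by (intro holomorphic_intros Cons.prems)
    qed
    have bd1: "cmod (P1 z) \<le> 2 * S / (R' - 1)" if z: "cmod z \<le> R'" for z
    proof (rule maximum_modulus_frontier[of P1 "cball 0 R'"])
      show "P1 holomorphic_on interior (cball 0 R')"
        by (rule holomorphic_on_subset[OF hol1]) (use R' in auto)
      show "continuous_on (closure (cball 0 R')) P1"
        by (rule holomorphic_on_imp_continuous_on, rule holomorphic_on_subset[OF hol1]) (use R' in auto)
      fix w :: complex assume "w \<in> frontier (cball 0 R')"
      then have w: "cmod w = R'" using R' by simp
      then have "cmod (w - z0) \<ge> R' - 1"
        using z0 norm_triangle_ineq2[of w z0] by simp
      moreover have "cmod (w - z0) * cmod (P1 w) \<le> 2 * S"
      proof -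
        have "cmod ((w - z0) * P1 w) = cmod (P w - P z0)" using P[of w] w R' by simp
        also have "\<dots> \<le> cmod (P w) + cmod (P z0)" by (rule norm_triangle_ineq4)
        also have "\<dots> \<le> S + S" using Cons.prems(9)[of w] Sz0 Pz0 w by (intro add_mono) auto
        finally show ?thesis by (simp add: norm_mult)
      qed
      ultimately have "(R' - 1) * cmod (P1 w) \<le> 2 * S"
        by (smt (verit) mult_right_mono norm_ge_zero)
      then show "cmod (P1 w) \<le> 2 * S / (R' - 1)" using R' by (simp add: field_simps)
    qed (use z in auto)
    have IH: "cmod (poly \<pi>1 x) \<le> (1 + 4 / (R' - 1)) ^ (length zs - 1) * (2 * S / (R' - 1))"
    proof (rule Cons.IH[of \<pi>1 P1])
      show "degree \<pi>1 < length zs" using Cons.prems(3) False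
        by (cases zs) (auto simp: \<pi>1_def degree_synthetic_div)
    qed (use Cons.prems False hol1 bd1 in \<open>auto simp: P1_def\<close>)
    define A where "A = (1 + 4 / (R' - 1)) ^ (length zs - 1)"
    have A: "A \<ge> 1" unfolding A_def using R' by (intro one_le_power) simp
    have "cmod (poly \<pi> x) \<le> cmod (poly \<pi> z0) + cmod (x - z0) * cmod (poly \<pi>1 x)"
      by (subst \<pi>) (metis norm_mult norm_triangle_ineq)
    also have "\<dots> \<le> S + 2 * (A * (2 * S / (R' - 1)))"
    proof (intro add_mono mult_mono)
      show "cmod (x - z0) \<le> 2" using norm_triangle_ineq4[of x z0] Cons.prems(10) z0 by simp
    qed (use Sz0 IH A_def in auto)
    also have "\<dots> \<le> A * S + 2 * (A * (2 * S / (R' - 1)))"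
      using A S mult_right_mono[of 1 A S] by simp
    also have "\<dots> = (1 + 4 / (R' - 1)) * A * S"
      using R' by (simp add: field_simps)
    also have "\<dots> = (1 + 4 / (R' - 1)) ^ (length (z0 # zs) - 1) * S"
      using False by (simp add: A_def flip: power_Suc)
    finally show ?thesis .
  qed
qed

text \<open>Newton interpolation without a holomorphic function outside the nodes: the leading
  coefficient is read off from the value at the last node, at the price of dividing by its distances
  to the earlier nodes. Only products over earlier nodes enter, so nodes chosen greedily in order
  are admissible.\<close>

lemma poly_interpolation_bound:
  fixes p :: "complex poly" and s :: "nat \<Rightarrow> complex"
  assumes "degree p \<le> k" "\<kappa> \<ge> 1"
    and "\<And>i. i \<le> k \<Longrightarrow> cmod (s i) \<le> 2"
    and "\<And>i. i \<le> k \<Longrightarrow> (\<Prod>j<i. cmod (s i - s j)) \<ge> 1 / \<kappa>"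
    and "\<And>i. i \<le> k \<Longrightarrow> cmod (poly p (s i)) \<le> S"
  shows "cmod (poly p x) \<le> (3 * \<kappa> * 4 ^ k) ^ k * (cmod x + 2) ^ k * S"
proof -
  have "cmod (poly p x) \<le> (3 * \<kappa> * 4 ^ k) ^ n * (cmod x + 2) ^ n * S"
    if "degree p \<le> n" "n \<le> k" "\<And>i. i \<le> n \<Longrightarrow> cmod (poly p (s i)) \<le> S" for n p x
    using that
  proof (induction n arbitrary: p x)
    case 0
    then obtain c where "p = [:c:]" by (metis degree_eq_zeroE le_zero_eq)
    then show ?case using "0.prems"(3)[of 0] by simp
  next
    case (Suc n)
    define c where "c = coeff p (Suc n)"
    define q where "q = (\<Prod>j<Suc n. [:- s j, 1:])"
    define p' where "p' = p - smult c q"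
    have q: "degree q = Suc n" "lead_coeff q = 1"
    proof -
      show "degree q = Suc n"
        unfolding q_def by (subst degree_prod_eq_sum_degree) (simp_all del: prod.lessThan_Suc)
      show "lead_coeff q = 1"
        unfolding q_def by (subst lead_coeff_prod) (simp del: prod.lessThan_Suc)
    qed
    have pq: "poly q z = (\<Prod>j<Suc n. z - s j)" for z
      unfolding q_def by (simp add: poly_prod del: prod.lessThan_Suc)
    have deg: "degree p' \<le> n"
    proof (rule degree_le, intro allI impI)
      fix i assume "n < i"
      then consider "i = Suc n" | "i > Suc n" by linarith
      then show "coeff p' i = 0"
        by cases (use q Suc.prems(1) in \<open>auto simp: p'_def c_def coeff_eq_0\<close>)
    qed
    have same: "poly p' (s i) = poly p (s i)" if "i \<le> n" for i
    proof -
      have "poly q (s i) = 0" using that by (auto simp: pq simp del: prod.lessThan_Suc)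
      then show ?thesis by (simp add: p'_def)
    qed
    have S: "S \<ge> 0" using Suc.prems(3)[of 0] norm_ge_zero order_trans by blast
    define A where "A = (3 * \<kappa> * 4 ^ k) ^ n"
    have B: "3 * \<kappa> * 4 ^ k \<ge> (1::real)"
    proof -
      have "1 * 1 \<le> \<kappa> * 4 ^ k" using assms(2) by (intro mult_mono) auto
      then show ?thesis by linarith
    qed
    have A: "A \<ge> 1" unfolding A_def by (rule one_le_power[OF B])
    have IH: "cmod (poly p' z) \<le> A * (cmod z + 2) ^ n * S" for z
      unfolding A_def by (rule Suc.IH) (use deg same Suc.prems in auto)
    have sS: "cmod (s (Suc n)) \<le> 2" using assms(3) Suc.prems by auto
    \<comment> \<open>At the node \<open>s (Suc n)\<close> the polynomials \<open>p\<close> and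
      \<open>p'\<close> differ by \<open>c * q\<close>, and both are under control there; 4 bounds
      \<open>cmod (s (Suc n)) + 2\<close>.\<close>
    have c: "cmod c \<le> \<kappa> * (2 * A * 4 ^ n * S)"
    proof -
      have "cmod c * (\<Prod>j<Suc n. cmod (s (Suc n) - s j)) = cmod (poly p (s (Suc n)) - poly p' (s (Suc n)))"
        by (simp add: p'_def pq norm_mult prod_norm del: prod.lessThan_Suc)
      also have "\<dots> \<le> S + A * (cmod (s (Suc n)) + 2) ^ n * S"
        using norm_triangle_ineq4[of "poly p (s (Suc n))" "poly p' (s (Suc n))"]
          Suc.prems(3)[of "Suc n"] IH[of "s (Suc n)"] by simp
      also have "\<dots> \<le> A * 4 ^ n * S + A * 4 ^ n * S"
      proof (intro add_mono mult_right_mono mult_left_mono power_mono S)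
        have "1 * 1 \<le> A * 4 ^ n" using A by (intro mult_mono) auto
        then have "1 * S \<le> A * 4 ^ n * S" using S by (intro mult_right_mono) auto
        then show "S \<le> A * 4 ^ n * S" by simp
      qed (use A sS in auto)
      finally have 1: "cmod c * (\<Prod>j<Suc n. cmod (s (Suc n) - s j)) \<le> 2 * A * 4 ^ n * S" by linarith
      have "cmod c * (1 / \<kappa>) \<le> cmod c * (\<Prod>j<Suc n. cmod (s (Suc n) - s j))"
        using assms(4)[of "Suc n"] Suc.prems by (intro mult_left_mono) auto
      then have "cmod c * (1 / \<kappa>) \<le> 2 * A * 4 ^ n * S" using 1 by linarith
      then show ?thesis using assms(2) by (simp add: field_simps)
    qed
    have qb: "cmod (poly q x) \<le> (cmod x + 2) ^ Suc n"
    proof -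
      have "(\<Prod>j<Suc n. cmod (x - s j)) \<le> (\<Prod>j<Suc n. cmod x + 2)"
      proof (intro prod_mono conjI)
        fix i assume "i \<in> {..<Suc n}"
        then show "cmod (x - s i) \<le> cmod x + 2"
          using norm_triangle_ineq4[of x "s i"] assms(3)[of i] Suc.prems by auto
      qed auto
      then show ?thesis by (simp add: pq prod_norm del: prod.lessThan_Suc power_Suc)
    qed
    define T where "T = (cmod x + 2) ^ Suc n"
    have T: "(cmod x + 2) ^ n \<le> T" "T \<ge> 0"
      unfolding T_def by (intro power_increasing) auto
    have "poly p x = poly p' x + c * poly q x" by (simp add: p'_def)
    then have "cmod (poly p x) \<le> cmod (poly p' x) + cmod c * cmod (poly q x)"
      by (metis norm_mult norm_triangle_ineq)
    also have "\<dots> \<le> A * T * S + \<kappa> * (2 * A * 4 ^ n * S) * T"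
    proof (intro add_mono mult_mono)
      show "cmod (poly p' x) \<le> A * T * S"
        using IH[of x] T A S by (meson mult_left_mono mult_right_mono order_trans zero_le_one)
    qed (use c qb A S assms(2) T_def in auto)
    also have "\<dots> = (1 + 2 * \<kappa> * 4 ^ n) * (A * T * S)"
      by (simp add: algebra_simps)
    also have "\<dots> \<le> (3 * \<kappa> * 4 ^ k) * (A * T * S)"
    proof (rule mult_right_mono)
      have "(4::real) ^ n \<le> 4 ^ k" using Suc.prems by (intro power_increasing) auto
      then have "\<kappa> * 4 ^ n \<le> \<kappa> * 4 ^ k" using assms(2) by simp
      moreover have "1 * 1 \<le> \<kappa> * 4 ^ k" using assms(2) by (intro mult_mono) auto
      ultimately show "1 + 2 * \<kappa> * 4 ^ n \<le> 3 * \<kappa> * 4 ^ k" by linarith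
    qed (use A T S in auto)
    finally show ?case by (simp add: A_def T_def mult_ac)
  qed
  from this[of p k x] show ?thesis using assms by blast
qed

text \<open>Leja's choice: the next point maximises \<open>|\<phi> z| \<Prod>\<^sub>j |z - s\<^sub>j|\<close> on the unit circle.\<close>

lemma leja_points:
  fixes \<phi> :: "complex \<Rightarrow> complex"
  assumes hol: "\<phi> holomorphic_on ball 0 R" "R > 1" and nz: "\<phi> 0 \<noteq> 0"
    and le: "\<And>s. cmod s \<le> 1 \<Longrightarrow> cmod (\<phi> s) \<le> K"
  shows "\<exists>s. \<forall>i<n. cmod (s i) = 1 \<and> cmod (\<phi> (s i)) \<ge> cmod (\<phi> 0) / 2 ^ i \<and>
                (\<Prod>j<i. cmod (s i - s j)) \<ge> cmod (\<phi> 0) / K"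
proof (induction n)
  case 0
  then show ?case by simp
next
  case (Suc n)
  then obtain s where s: "\<And>i. i < n \<Longrightarrow> cmod (s i) = 1"
    "\<And>i. i < n \<Longrightarrow> cmod (\<phi> (s i)) \<ge> cmod (\<phi> 0) / 2 ^ i"
    "\<And>i. i < n \<Longrightarrow> (\<Prod>j<i. cmod (s i - s j)) \<ge> cmod (\<phi> 0) / K"
    by blast
  have K: "K > 0" using le[of 0] nz by (smt (verit) norm_zero zero_less_norm_iff)
  define h where "h = (\<lambda>z. \<phi> z * (\<Prod>j<n. z - s j))"
  have holh: "h holomorphic_on ball 0 R"
    unfolding h_def by (intro holomorphic_intros hol)
  \<comment> \<open>The nodes lie on the unit circle, so \<open>h\<close> and \<open>\<phi>\<close>
    have the same modulus at 0; the maximum principle moves this value to the circle.\<close>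
  have "\<exists>z. cmod z = 1 \<and> cmod (h z) \<ge> cmod (\<phi> 0)"
  proof (rule ccontr)
    assume "\<not> ?thesis"
    then have lt: "\<And>z. cmod z = 1 \<Longrightarrow> cmod (h z) < cmod (\<phi> 0)" by force
    have cont: "continuous_on (sphere 0 1) (\<lambda>z. cmod (h z))"
      by (intro continuous_intros holomorphic_on_imp_continuous_on holomorphic_on_subset[OF holh])
        (use hol(2) in auto)
    have "sphere 0 1 \<noteq> ({}::complex set)" by (simp add: sphere_eq_empty)
    then obtain z where z: "cmod z = 1" "\<And>w. cmod w = 1 \<Longrightarrow> cmod (h w) \<le> cmod (h z)"
      using continuous_attains_sup[OF compact_sphere _ cont] by auto
    have "cmod (h 0) \<le> cmod (h z)"
    proof (rule maximum_modulus_frontier[of h "cball 0 1"])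
      show "h holomorphic_on interior (cball 0 1)"
        by (rule holomorphic_on_subset[OF holh]) (use hol(2) in auto)
      show "continuous_on (closure (cball 0 1)) h"
        by (rule holomorphic_on_imp_continuous_on, rule holomorphic_on_subset[OF holh]) (use hol(2) in auto)
    qed (use z in auto)
    moreover have "(\<Prod>j<n. cmod (s j)) = 1" using s by simp
    then have "cmod (h 0) = cmod (\<phi> 0)"
      by (simp add: h_def norm_mult flip: prod_norm)
    ultimately show False using lt[OF z(1)] by simp
  qed
  then obtain z where z: "cmod z = 1" "cmod (\<phi> z) * (\<Prod>j<n. cmod (z - s j)) \<ge> cmod (\<phi> 0)"
    by (auto simp: h_def norm_mult prod_norm)
  \<comment> \<open>One lower bound for a product of two factors yields one for each: bounding the
    distances by 2 keeps \<open>\<phi>\<close> large at \<open>z\<close>, bounding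
    \<open>\<phi>\<close> by \<open>K\<close> keeps \<open>z\<close> away from the earlier
    nodes.\<close>
  have "(\<Prod>j<n. cmod (z - s j)) \<le> (\<Prod>j<n. 2)"
  proof (intro prod_mono conjI)
    fix i assume "i \<in> {..<n}"
    then show "cmod (z - s i) \<le> 2"
      using norm_triangle_ineq4[of z "s i"] s(1)[of i] z by auto
  qed auto
  then have p2: "(\<Prod>j<n. cmod (z - s j)) \<le> 2 ^ n" by simp
  have "cmod (\<phi> 0) \<le> cmod (\<phi> z) * 2 ^ n"
    using z(2) p2 by (smt (verit) mult_left_mono norm_ge_zero)
  then have 1: "cmod (\<phi> z) \<ge> cmod (\<phi> 0) / 2 ^ n" by (simp add: field_simps)
  have "cmod (\<phi> 0) \<le> K * (\<Prod>j<n. cmod (z - s j))"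
    using z(2) le[of z] z(1) by (smt (verit) mult_right_mono norm_ge_zero prod_nonneg)
  then have 2: "(\<Prod>j<n. cmod (z - s j)) \<ge> cmod (\<phi> 0) / K" using K by (simp add: field_simps)
  show ?case
  proof (intro exI[of _ "s(n := z)"] allI impI)
    fix i assume i: "i < Suc n"
    have eq: "(\<Prod>j<i. cmod (y - (s(n := z)) j)) = (\<Prod>j<i. cmod (y - s j))" for y
      using i by (intro prod.cong) auto
    show "cmod ((s(n := z)) i) = 1 \<and> cmod (\<phi> 0) / 2 ^ i \<le> cmod (\<phi> ((s(n := z)) i)) \<and>
         cmod (\<phi> 0) / K \<le> (\<Prod>j<i. cmod ((s(n := z)) i - (s(n := z)) j))"
      unfolding eq using s[of i] z 1 2 i by (cases "i = n") auto
  qed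
qed

text \<open>The factorization counts zeros with multiplicity, and \<open>H\<close> may vanish, so at
  least \<open>m\<close> zeros are meant. It holds on all of \<open>ball 0 R\<close>, beyond the
  unit disc containing the zeros, as the remainder term of an interpolation on a larger circle
  requires.\<close>

definition has_roots_in_disc :: "(complex \<Rightarrow> complex) \<Rightarrow> real \<Rightarrow> nat \<Rightarrow> bool" where
  "has_roots_in_disc F R m \<longleftrightarrow>
     (\<exists>zs H. set zs \<subseteq> ball 0 1 \<and> length zs = m \<and> H holomorphic_on ball 0 R \<and>
        (\<forall>z\<in>ball 0 R. F z = (\<Prod>x\<leftarrow>zs. z - x) * H z))"

lemma norm_diff_le_norm_one_minus_cnj_mult:
  assumes "cmod x \<le> 1" "cmod z \<le> 1"
  shows "cmod (z - x) \<le> cmod (1 - cnj x * z)"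
proof -
  have id: "(cmod (1 - cnj x * z))\<^sup>2 - (cmod (z - x))\<^sup>2 = (1 - (cmod x)\<^sup>2) * (1 - (cmod z)\<^sup>2)"
    unfolding cmod_power2 by (simp add: power2_eq_square algebra_simps)
  have "(cmod x)\<^sup>2 \<le> 1" "(cmod z)\<^sup>2 \<le> 1" using assms by (simp_all add: power_le_one)
  then have "(1 - (cmod x)\<^sup>2) * (1 - (cmod z)\<^sup>2) \<ge> 0" by simp
  then have "(cmod (z - x))\<^sup>2 \<le> (cmod (1 - cnj x * z))\<^sup>2" using id by linarith
  then show ?thesis by (rule power2_le_imp_le) simp
qed

lemma norm_one_minus_cnj_mult_unit:
  assumes "cmod z = 1"
  shows "cmod (1 - cnj x * z) = cmod (z - x)"
proof -
  have "1 - cnj x * z = z * cnj (z - x)"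
    using assms by (simp add: algebra_simps flip: complex_norm_square)
  then have "cmod (1 - cnj x * z) = cmod z * cmod (cnj (z - x))" by (simp only: norm_mult)
  then show ?thesis unfolding complex_mod_cnj assms by simp
qed

lemma norm_prod_list: "cmod (\<Prod>x\<leftarrow>zs. f x) = (\<Prod>x\<leftarrow>zs. cmod (f x))"
  by (induction zs) (simp_all add: norm_mult)

text \<open>Dividing by Blaschke factors instead of linear ones keeps the maximum on the unit circle.\<close>

lemma divide_by_blaschke_product:
  assumes hol: "F holomorphic_on ball 0 R" and R: "R > 1"
    and few: "\<not> has_roots_in_disc F R (Suc k)"
    and K: "\<And>z. cmod z = 1 \<Longrightarrow> cmod (F z) \<le> K"
    and r0: "0 < r0" "r0 \<le> 1" and nz: "\<And>z. cmod z < r0 \<Longrightarrow> F z \<noteq> 0"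
  obtains G where "G holomorphic_on ball 0 R"
    "\<And>z. cmod z < 1 \<Longrightarrow> G z \<noteq> 0" "\<And>z. cmod z \<le> 1 \<Longrightarrow> cmod (G z) \<le> K"
    "\<And>z. cmod z < 1 \<Longrightarrow> cmod (F z) \<le> cmod (G z)"
    "cmod (G 0) \<le> cmod (F 0) * (1 / r0) ^ k"
proof -
  have "ball (0::complex) 1 \<subseteq> ball 0 R" using R by auto
  from divide_roots_dichotomy[OF hol open_ball this, of "Suc k"]
  obtain zs H where zs: "set zs \<subseteq> ball 0 1" "length zs \<le> Suc k" "H holomorphic_on ball 0 R"
    "\<And>z. z \<in> ball 0 R \<Longrightarrow> F z = (\<Prod>x\<leftarrow>zs. z - x) * H z"
    "length zs = Suc k \<or> (\<forall>z\<in>ball 0 1. H z \<noteq> 0)" by blast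
  have "length zs \<noteq> Suc k" using few zs unfolding has_roots_in_disc_def by blast
  then have len: "length zs \<le> k" and Hnz: "\<And>z. cmod z < 1 \<Longrightarrow> H z \<noteq> 0" using zs by auto
  have x1: "cmod x < 1" if "x \<in> set zs" for x using zs that by auto
  \<comment> \<open>This is \<open>F\<close> divided by the Blaschke product of \<open>zs\<close>,
    written without a quotient: the factors \<open>z - x\<close> of \<open>F\<close> are exchanged
    for the denominators \<open>1 - cnj x * z\<close>.\<close>
  define G where "G = (\<lambda>z. (\<Prod>x\<leftarrow>zs. 1 - cnj x * z) * H z)"
  have holG: "G holomorphic_on ball 0 R"
  proof -
    have "(\<lambda>z. \<Prod>x\<leftarrow>zs. 1 - cnj x * z) holomorphic_on ball 0 R"
      by (induction zs) (auto intro!: holomorphic_intros)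
    then show ?thesis unfolding G_def by (intro holomorphic_intros zs)
  qed
  show thesis
  proof (rule that[OF holG])
    fix z :: complex assume z: "cmod z < 1"
    have "cmod (cnj x * z) < 1" if "x \<in> set zs" for x
      using mult_strict_mono'[OF x1[OF that] z] by (simp add: norm_mult)
    then have "1 - cnj x * z \<noteq> 0" if "x \<in> set zs" for x
      using that by force
    then have "(\<Prod>x\<leftarrow>zs. 1 - cnj x * z) \<noteq> 0"
      by (auto simp: prod_list_zero_iff)
    then show "G z \<noteq> 0" using Hnz[OF z] by (simp add: G_def)
    have "(\<Prod>x\<leftarrow>zs. cmod (z - x)) \<le> (\<Prod>x\<leftarrow>zs. cmod (1 - cnj x * z))"
      using x1
    proof (induction zs)
      case (Cons y ys)
      then show ?case using norm_diff_le_norm_one_minus_cnj_mult[of y z] z less_imp_le[OF Cons.prems]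
        by (auto intro!: mult_mono prod_list_nonneg)
    qed auto
    then show "cmod (F z) \<le> cmod (G z)"
      using zs(4)[of z] z R by (simp add: G_def norm_mult norm_prod_list mult_right_mono)
  next
    fix z :: complex assume z: "cmod z \<le> 1"
    show "cmod (G z) \<le> K"
    proof (rule maximum_modulus_frontier[of G "cball 0 1"])
      show "G holomorphic_on interior (cball 0 1)"
        by (rule holomorphic_on_subset[OF holG]) (use R in auto)
      show "continuous_on (closure (cball 0 1)) G"
        by (rule holomorphic_on_imp_continuous_on, rule holomorphic_on_subset[OF holG]) (use R in auto)
      fix w :: complex assume "w \<in> frontier (cball 0 1)"
      then have w: "cmod w = 1" by simp
      then have "cmod (G w) = cmod (F w)"
        using zs(4)[of w] R by (simp add: G_def norm_mult norm_prod_list norm_one_minus_cnj_mult_unit)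
      then show "cmod (G w) \<le> K" using K[OF w] by simp
    qed (use z in auto)
  next
    \<comment> \<open>All zeros lie outside the disc of radius \<open>r0\<close>, so each of the at
      most \<open>k\<close> factors removed at 0 has modulus at least \<open>r0\<close>.\<close>
    have "r0 \<le> cmod x" if "x \<in> set zs" for x
    proof (rule ccontr)
      assume "\<not> r0 \<le> cmod x"
      then have "F x \<noteq> 0" using nz[of x] by simp
      moreover have "F x = 0" using zs(4)[of x] x1[OF that] R that by (auto simp: prod_list_zero_iff)
      ultimately show False by simp
    qed
    then have "r0 ^ length zs \<le> (\<Prod>x\<leftarrow>zs. cmod x)"
      by (induction zs) (use r0 in \<open>auto intro!: mult_mono\<close>)
    moreover have "r0 ^ k \<le> r0 ^ length zs" using r0 len by (intro power_decreasing) auto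
    ultimately have "r0 ^ k * cmod (H 0) \<le> (\<Prod>x\<leftarrow>zs. cmod x) * cmod (H 0)"
      by (intro mult_right_mono) auto
    also have "\<dots> = cmod (F 0)" using zs(4)[of 0] R by (simp add: norm_mult norm_prod_list)
    finally have "r0 ^ k * cmod (H 0) \<le> cmod (F 0)" .
    moreover have "(\<Prod>x\<leftarrow>zs. 1 - cnj x * 0) = 1" by (induction zs) auto
    then have "cmod (G 0) = cmod (H 0)" by (simp add: G_def)
    ultimately show "cmod (G 0) \<le> cmod (F 0) * (1 / r0) ^ k"
      using r0 by (simp add: field_simps power_divide)
  qed
qed

text \<open>A quantitative Picard theorem. If \<open>g - \<rho> w\<close> has at most \<open>k\<close> zeros for every \<open>w \<in> W\<close>, then
  the product of these functions is, after removal of the zeros, bounded below: at each point all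
  factors but one are at least \<open>\<rho> \<sigma> / 2\<close> in modulus, and Harnack's inequality bounds the exceptional
  factor. Harnack's inequality for the product then limits the growth of \<open>g\<close> from \<open>0\<close> to \<open>a\<close>.\<close>

lemma few_preimages_limit_growth:
  fixes g :: "complex \<Rightarrow> complex" and W :: "complex set"
  assumes hol: "g holomorphic_on ball 0 R" and R: "R > 1" and \<rho>: "\<rho> > 0"
    and K: "\<And>z. cmod z \<le> 1 \<Longrightarrow> cmod (g z) \<le> K"
    and r0: "0 < r0" "r0 \<le> 1" "\<And>z. cmod z \<le> r0 \<Longrightarrow> cmod (g z) \<le> \<rho> / 2"
    and r: "cmod a < r" "r < 1"
    and Y: "cmod (g a) \<ge> \<rho> * exp Y" "Y \<ge> ln 4"
    and W: "finite W" "\<And>w. w \<in> W \<Longrightarrow> 1 \<le> cmod w \<and> cmod w \<le> 2"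
    and sep: "\<And>v w. v \<in> W \<Longrightarrow> w \<in> W \<Longrightarrow> v \<noteq> w \<Longrightarrow> cmod (v - w) \<ge> \<sigma>" and \<sigma>: "0 < \<sigma>" "\<sigma> \<le> 1"
    and few: "\<And>w. w \<in> W \<Longrightarrow> \<not> has_roots_in_disc (\<lambda>z. g z - of_real \<rho> * w) R (Suc k)"
  shows "real (card W) * Y \<le> 2 / (r - cmod a) *
           (real (card W) * (ln (5 / \<sigma>) + real k * ln (1 / r0)) + 2 / (1 - r) * ln (2 * (K + 2 * \<rho>) / \<rho>))"
proof -
  define K' where "K' = K + 2 * \<rho>"
  have K0: "K \<ge> 0" using K[of 0] norm_ge_zero[of "g 0"] by (simp del: norm_ge_zero)
  have K': "K' \<ge> 2 * \<rho>" "K' > 0" using K0 \<rho> by (auto simp: K'_def)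
  have r_pos: "r > 0" using r(1) norm_ge_zero[of a] by linarith
  define F where "F = (\<lambda>w z. g z - of_real \<rho> * w)"
  have nF: "cmod (F w z) \<le> cmod (g z) + 2 * \<rho>" if "w \<in> W" for w z
  proof -
    have "cmod (F w z) \<le> cmod (g z) + cmod (of_real \<rho> * w)"
      unfolding F_def by (rule norm_triangle_ineq4)
    also have "cmod (of_real \<rho> * w) \<le> 2 * \<rho>" using W(2)[OF that] \<rho> by (simp add: norm_mult)
    finally show ?thesis by simp
  qed
  have lF: "cmod (F w z) \<ge> \<rho> / 2" if "w \<in> W" "cmod z \<le> r0" for w z
  proof -
    have "cmod (F w z) \<ge> cmod (of_real \<rho> * w) - cmod (g z)"
      unfolding F_def using norm_triangle_ineq2[of "of_real \<rho> * w" "g z"] by (simp add: norm_minus_commute)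
    moreover have "cmod (of_real \<rho> * w) \<ge> \<rho>" using W(2)[OF that(1)] \<rho> by (simp add: norm_mult)
    ultimately show ?thesis using r0(3)[OF that(2)] by linarith
  qed
  define Q where "Q = (\<lambda>w G. G holomorphic_on ball 0 R \<and>
    (\<forall>z. cmod z < 1 \<longrightarrow> G z \<noteq> 0) \<and> (\<forall>z. cmod z \<le> 1 \<longrightarrow> cmod (G z) \<le> K') \<and>
    (\<forall>z. cmod z < 1 \<longrightarrow> cmod (F w z) \<le> cmod (G z)) \<and>
    cmod (G 0) \<le> cmod (F w 0) * (1 / r0) ^ k)"
  have "\<exists>G. Q w G" if w: "w \<in> W" for w
  proof -
    have h: "F w holomorphic_on ball 0 R" unfolding F_def by (intro holomorphic_intros hol)
    have f: "\<not> has_roots_in_disc (F w) R (Suc k)" unfolding F_def by (rule few[OF w])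
    have b: "cmod (F w z) \<le> K'" if "cmod z = 1" for z
      using nF[OF w, of z] K[of z] that by (simp add: K'_def)
    have n: "F w z \<noteq> 0" if "cmod z < r0" for z using lF[OF w, of z] \<rho> that by auto
    show ?thesis unfolding Q_def
      by (rule divide_by_blaschke_product[OF h R f b r0(1,2) n]) blast+
  qed
  then obtain G where "\<And>w. w \<in> W \<Longrightarrow> Q w (G w)" by metis
  then have G: "\<And>w. w \<in> W \<Longrightarrow> G w holomorphic_on ball 0 R"
    "\<And>w z. w \<in> W \<Longrightarrow> cmod z < 1 \<Longrightarrow> G w z \<noteq> 0"
    "\<And>w z. w \<in> W \<Longrightarrow> cmod z \<le> 1 \<Longrightarrow> cmod (G w z) \<le> K'"
    "\<And>w z. w \<in> W \<Longrightarrow> cmod z < 1 \<Longrightarrow> cmod (F w z) \<le> cmod (G w z)"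
    "\<And>w. w \<in> W \<Longrightarrow> cmod (G w 0) \<le> cmod (F w 0) * (1 / r0) ^ k"
    unfolding Q_def by blast+
  \<comment> \<open>The Harnack cost of one factor: \<open>G w\<close> starts at 0 with modulus at
    least \<open>\<rho> / 2\<close>, is bounded by \<open>K'\<close> and has no zeros in the unit
    disc, so it can fall below \<open>K'\<close> by at most \<open>exp (- E)\<close> inside radius
    \<open>r\<close>.\<close>
  define E where "E = 2 / (1 - r) * ln (2 * K' / \<rho>)"
  have lnpos: "ln (2 * K' / \<rho>) \<ge> 0" using K' \<rho> by (simp add: field_simps)
  then have E: "E \<ge> 0" unfolding E_def using r by (intro mult_nonneg_nonneg) auto
  have low: "cmod (G w z) \<ge> K' * exp (- E)" if w: "w \<in> W" and z: "cmod z < r" for w z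
  proof -
    have z1: "cmod z < 1" using z r by simp
    have G0: "cmod (G w 0) \<ge> \<rho> / 2" using lF[OF w, of 0] G(4)[OF w, of 0] r0 by simp
    have "ln (K' / cmod (G w z)) \<le> (1 + cmod z) / (1 - cmod z) * ln (K' / cmod (G w 0))"
    proof (rule harnack_zero_free)
      show "G w holomorphic_on ball 0 1" by (rule holomorphic_on_subset[OF G(1)[OF w]]) (use R in auto)
    qed (use G[OF w] z1 in auto)
    also have "\<dots> \<le> 2 / (1 - r) * ln (2 * K' / \<rho>)"
    proof (rule mult_mono)
      show "(1 + cmod z) / (1 - cmod z) \<le> 2 / (1 - r)" using z r by (intro frac_le) auto
      show "ln (K' / cmod (G w 0)) \<le> ln (2 * K' / \<rho>)"
      proof (subst ln_le_cancel_iff)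
        have "K' / cmod (G w 0) \<le> K' / (\<rho> / 2)"
          using G0 \<rho> K' by (intro divide_left_mono mult_pos_pos) auto
        then show "K' / cmod (G w 0) \<le> 2 * K' / \<rho>" by (simp add: mult.commute)
      qed (use G(2)[OF w, of 0] K' \<rho> in auto)
      show "0 \<le> ln (K' / cmod (G w 0))" using G(2,3)[OF w, of 0] K' by simp
    qed (use r in auto)
    finally have "ln (K' / cmod (G w z)) \<le> E" by (simp add: E_def)
    then have "K' / cmod (G w z) \<le> exp E"
      using G(2)[OF w z1] K' by (metis divide_pos_pos exp_le_cancel_iff exp_ln zero_less_norm_iff)
    then show ?thesis using G(2)[OF w z1] by (simp add: exp_minus field_simps)
  qed
  define \<Phi> where "\<Phi> = (\<lambda>z. \<Prod>w\<in>W. G w z)"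
  \<comment> \<open>The cost \<open>E\<close> occurs once and not once per value of
    \<open>W\<close>: this is the gain from multiplying the functions for all
    \<open>w\<close>.\<close>
  define c where "c = (\<rho> * \<sigma> / 2) ^ card W * exp (- E)"
  have c: "c > 0" using \<rho> \<sigma> by (simp add: c_def)
  have \<Phi>low: "cmod (\<Phi> z) \<ge> c" if z: "cmod z < r" for z
  proof -
    \<comment> \<open>The values too close to \<open>g z / \<rho>\<close>; since \<open>W\<close> is
      separated by \<open>\<sigma>\<close>, at most one exists for each \<open>z\<close>, though
      which one may depend on \<open>z\<close>.\<close>
    define A where "A = {w\<in>W. cmod (F w z) < \<rho> * \<sigma> / 2}"
    have z1: "cmod z < 1" using z r by simp
    have uniq: "v = w" if "v \<in> A" "w \<in> A" for v w
    proof (rule ccontr)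
      assume "v \<noteq> w"
      then have "cmod (v - w) \<ge> \<sigma>" using sep that by (auto simp: A_def)
      moreover have "\<rho> * cmod (v - w) = cmod (F w z - F v z)"
        using \<rho> by (simp add: F_def norm_mult flip: right_diff_distrib)
      moreover have "cmod (F w z - F v z) < \<rho> * \<sigma>"
        using norm_triangle_ineq4[of "F w z" "F v z"] that by (auto simp: A_def)
      ultimately show False using \<rho> mult_left_mono[of \<sigma> "cmod (v - w)" \<rho>] by linarith
    qed
    have finA: "finite A" using W by (auto simp: A_def)
    have cardA: "card A \<le> 1" using uniq finA by (auto simp: card_le_Suc0_iff_eq)
    have "c \<le> (\<Prod>w\<in>W. \<rho> * \<sigma> / 2 * (if w \<in> A then exp (- E) else 1))"
    proof -
      have "(\<Prod>w\<in>W. (if w \<in> A then exp (- E) else 1)) = exp (- E) ^ card A"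
      proof -
        have "(\<Prod>w\<in>W. (if w \<in> A then exp (- E) else 1)) = (\<Prod>w\<in>A. exp (- E))"
          using W(1) by (intro prod.mono_neutral_cong_right) (auto simp: A_def)
        then show ?thesis by simp
      qed
      moreover have "exp (- E) ^ card A \<ge> exp (- E)"
        using power_decreasing[OF cardA, of "exp (- E)"] E by simp
      ultimately show ?thesis
        unfolding c_def prod.distrib prod_constant using \<rho> \<sigma> by (intro mult_left_mono) auto
    qed
    also have "\<dots> \<le> (\<Prod>w\<in>W. cmod (G w z))"
    proof (intro prod_mono conjI)
      fix w assume w: "w \<in> W"
      show "\<rho> * \<sigma> / 2 * (if w \<in> A then exp (- E) else 1) \<le> cmod (G w z)"
      proof (cases "w \<in> A")
        case True
        have "\<rho> * \<sigma> \<le> \<rho> * 1" using \<rho> \<sigma> by (intro mult_left_mono) auto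
        then have "\<rho> * \<sigma> / 2 \<le> K'" using K' \<rho> by linarith
        then have "\<rho> * \<sigma> / 2 * exp (- E) \<le> K' * exp (- E)" by (intro mult_right_mono) auto
        then have "\<rho> * \<sigma> / 2 * exp (- E) \<le> cmod (G w z)" using low[OF w z] by linarith
        then show ?thesis by (simp only: True if_True)
      next
        case False
        then show ?thesis using G(4)[OF w z1] w by (auto simp: A_def)
      qed
    qed (use \<rho> \<sigma> in auto)
    also have "\<dots> = cmod (\<Phi> z)" by (simp add: \<Phi>_def prod_norm)
    finally show ?thesis .
  qed
  have hol\<Phi>: "\<Phi> holomorphic_on ball 0 r"
    unfolding \<Phi>_def by (intro holomorphic_intros holomorphic_on_subset[OF G(1)]) (use R r in auto)
  have \<Phi>nz: "\<Phi> z \<noteq> 0" if "cmod z < r" for z using \<Phi>low[OF that] c by auto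
  \<comment> \<open>Harnack is applied to the reciprocal, as \<open>\<Phi>\<close> is bounded below;
    it then limits the growth of \<open>\<Phi>\<close> from 0 to \<open>a\<close>.\<close>
  have "ln ((1 / c) / cmod (1 / \<Phi> a)) \<le> (r + cmod a) / (r - cmod a) * ln ((1 / c) / cmod (1 / \<Phi> 0))"
  proof (rule harnack_zero_free)
    show "(\<lambda>z. 1 / \<Phi> z) holomorphic_on ball 0 r"
      by (intro holomorphic_intros hol\<Phi>) (use \<Phi>nz in auto)
    show "cmod (1 / \<Phi> z) \<le> 1 / c" if "cmod z < r" for z
      using \<Phi>low[OF that] c \<Phi>nz[OF that] by (simp add: norm_divide frac_le)
  qed (use r r_pos \<Phi>nz in auto)
  then have main: "ln (cmod (\<Phi> a) / c) \<le> (r + cmod a) / (r - cmod a) * ln (cmod (\<Phi> 0) / c)"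
    by (simp add: norm_divide)
  have lnc: "ln c = card W * ln (\<rho> * \<sigma> / 2) - E"
    using \<rho> \<sigma> by (simp add: c_def ln_mult ln_realpow)
  have up0: "ln (cmod (\<Phi> 0) / c) \<le> card W * (ln (5 / \<sigma>) + k * ln (1 / r0)) + E"
  proof -
    have "cmod (\<Phi> 0) \<le> (\<Prod>w\<in>W. (5 / 2 * \<rho>) * (1 / r0) ^ k)"
      unfolding \<Phi>_def prod_norm[symmetric]
    proof (intro prod_mono conjI)
      fix w assume w: "w \<in> W"
      have "cmod (F w 0) \<le> 5 / 2 * \<rho>" using nF[OF w, of 0] r0(3)[of 0] r0(1) by simp
      then have "cmod (F w 0) * (1 / r0) ^ k \<le> (5 / 2 * \<rho>) * (1 / r0) ^ k"
        using r0 by (intro mult_right_mono) auto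
      then show "cmod (G w 0) \<le> (5 / 2 * \<rho>) * (1 / r0) ^ k"
        using G(5)[OF w] by linarith
    qed auto
    then have "ln (cmod (\<Phi> 0)) \<le> ln (((5 / 2 * \<rho>) * (1 / r0) ^ k) ^ card W)"
      using \<Phi>nz[of 0] r_pos \<rho> r0(1) by (subst ln_le_cancel_iff) auto
    also have "\<dots> = card W * (ln (5 / 2 * \<rho>) + k * ln (1 / r0))"
    proof -
      have "ln ((5 / 2 * \<rho>) * (1 / r0) ^ k) = ln (5 / 2 * \<rho>) + ln ((1 / r0) ^ k)"
        using \<rho> r0(1) by (subst ln_mult) auto
      also have "ln ((1 / r0) ^ k) = k * ln (1 / r0)" by (rule ln_realpow)
      finally show ?thesis by (simp only: ln_realpow)
    qed
    finally have "ln (cmod (\<Phi> 0) / c) \<le> card W * (ln (5 / 2 * \<rho>) + k * ln (1 / r0)) - (card W * ln (\<rho> * \<sigma> / 2) - E)"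
      using \<Phi>nz[of 0] r_pos c by (simp add: ln_div lnc)
    also have "\<dots> = card W * ((ln (5 / 2 * \<rho>) - ln (\<rho> * \<sigma> / 2)) + k * ln (1 / r0)) + E"
      by (simp add: algebra_simps)
    also have "ln (5 / 2 * \<rho>) - ln (\<rho> * \<sigma> / 2) = ln (5 / \<sigma>)"
      using \<rho> \<sigma> by (simp add: ln_div ln_mult)
    finally show ?thesis .
  qed
  have lowa: "ln (cmod (\<Phi> a) / c) \<ge> card W * Y"
  proof -
    have "(\<Prod>w\<in>W. \<rho> * exp Y / 2) \<le> cmod (\<Phi> a)"
      unfolding \<Phi>_def prod_norm[symmetric]
    proof (intro prod_mono conjI)
      fix w assume w: "w \<in> W"
      have "exp Y \<ge> 4" using Y(2) by (metis exp_le_cancel_iff exp_ln zero_less_numeral)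
      then have "\<rho> * exp Y \<ge> 4 * \<rho>" using \<rho> by simp
      moreover have "cmod (g a) \<le> cmod (F w a) + cmod (of_real \<rho> * w)"
        using norm_triangle_ineq[of "F w a" "of_real \<rho> * w"] by (simp add: F_def)
      moreover have "cmod (of_real \<rho> * w) \<le> 2 * \<rho>" using W(2)[OF w] \<rho> by (simp add: norm_mult)
      moreover have "cmod (F w a) \<le> cmod (G w a)" using G(4)[OF w, of a] r by simp
      ultimately show "\<rho> * exp Y / 2 \<le> cmod (G w a)" using Y(1) by linarith
    qed (use \<rho> in auto)
    then have "ln ((\<rho> * exp Y / 2) ^ card W) \<le> ln (cmod (\<Phi> a))"
      using \<Phi>nz[OF r(1)] \<rho> by (subst ln_le_cancel_iff) auto
    then have "card W * (ln \<rho> + Y - ln 2) - ln c \<le> ln (cmod (\<Phi> a) / c)"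
      using \<Phi>nz[OF r(1)] \<rho> c by (simp add: ln_realpow ln_mult ln_div)
    moreover have "card W * (ln \<rho> + Y - ln 2) - ln c = card W * (Y - ln \<sigma>) + E"
      using \<rho> \<sigma> by (simp add: lnc ln_mult ln_div algebra_simps)
    moreover have "card W * (Y - ln \<sigma>) \<ge> card W * Y"
      using \<sigma> by (intro mult_left_mono) auto
    ultimately show ?thesis using E by linarith
  qed
  have "ln (cmod (\<Phi> 0) / c) \<ge> 0" using \<Phi>low[of 0] r_pos c by simp
  then have "(r + cmod a) / (r - cmod a) * ln (cmod (\<Phi> 0) / c) \<le> 2 / (r - cmod a) * ln (cmod (\<Phi> 0) / c)"
    using r by (intro mult_right_mono divide_right_mono) auto
  also have "\<dots> \<le> 2 / (r - cmod a) * (card W * (ln (5 / \<sigma>) + k * ln (1 / r0)) + E)"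
    using r up0 by (intro mult_left_mono) auto
  finally show ?thesis using main lowa by (simp add: E_def K'_def)
qed

section \<open>Entire functions and polynomials of several variables\<close>

text \<open>Unlike a graph point, the last coordinate is independent of \<open>z\<close>: the proof
  evaluates \<open>p\<close> off the graph, with \<open>w\<close> or \<open>z\<close> varied
  alone.\<close>

definition join_point :: "complex ^ 'n \<Rightarrow> complex \<Rightarrow> complex ^ ('n + 1)" where
  "join_point z w = (\<chi> i. case i of Inl a \<Rightarrow> z $ a | Inr b \<Rightarrow> w)"

lemma graph_point_vec: "graph_point (\<lambda>z. vec (f z) :: complex ^ 1) z = join_point z (f z)"
  by (auto simp: graph_point_def join_point_def vec_eq_iff split: sum.split)

lemma norm_cscale: "norm (c *s v) = cmod c * norm (v :: complex ^ 'n)"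
  by (simp add: norm_vec_def norm_mult L2_set_right_distrib)

lemma bounded_linear_cscale_left: "bounded_linear (\<lambda>c. c *s (v :: complex ^ 'n))"
  by (rule bounded_linear_intro[of _ "norm v"])
    (simp_all add: norm_cscale vector_sadd_rdistrib vec_eq_iff algebra_simps)

lemma entire_imp_continuous_on: "entire f \<Longrightarrow> continuous_on S f"
  unfolding entire_def
  by (meson continuous_at_imp_continuous_on has_derivative_continuous)

lemma entire_imp_holomorphic_line:
  assumes "entire f"
  shows "(\<lambda>s. f (A + s *s B)) holomorphic_on S"
proof -
  have "(\<lambda>s. f (A + s *s B)) field_differentiable at s" for s
  proof -
    obtain D where D: "(f has_derivative D) (at (A + s *s B))" "\<And>c v. D (c *s v) = c * D v"
      using assms unfolding entire_def by blast
    have "((\<lambda>s. A + s *s B) has_derivative (\<lambda>h. h *s B)) (at s)"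
      by (rule derivative_eq_intros bounded_linear.has_derivative[OF bounded_linear_cscale_left] refl)+ simp
    then have "((\<lambda>s. f (A + s *s B)) has_derivative (\<lambda>h. D (h *s B))) (at s)"
      using D(1) by (rule has_derivative_compose)
    then have "((\<lambda>s. f (A + s *s B)) has_derivative (*) (D B)) (at s)"
      by (simp add: D(2) mult.commute[of _ "D B"])
    then show ?thesis unfolding field_differentiable_def has_field_derivative_def by blast
  qed
  then show ?thesis
    by (simp add: holomorphic_on_def field_differentiable_at_within)
qed

lemma cpoly_eval_line:
  fixes p :: "'v::finite cpoly"
  obtains q where "degree q \<le> cpoly_degree p" "\<And>s. poly q s = cpoly_eval p (A + s *s B)"
proof
  define q where "q = (\<Sum>m\<in>Poly_Mapping.keys p. smult (Poly_Mapping.lookup p m)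
      (\<Prod>i\<in>UNIV. [:A $ i, B $ i:] ^ Poly_Mapping.lookup m i))"
  show "poly q s = cpoly_eval p (A + s *s B)" for s
    by (simp add: q_def cpoly_eval_def poly_sum poly_prod algebra_simps)
  show "degree q \<le> cpoly_degree p"
    unfolding q_def
  proof (rule degree_sum_le)
    fix m assume m: "m \<in> Poly_Mapping.keys p"
    have "degree (\<Prod>i\<in>UNIV. [:A $ i, B $ i:] ^ Poly_Mapping.lookup m i)
        \<le> (\<Sum>i\<in>UNIV. degree ([:A $ i, B $ i:] ^ Poly_Mapping.lookup m i))"
      by (rule degree_prod_sum_le[unfolded o_def]) simp
    also have "\<dots> \<le> (\<Sum>i\<in>UNIV. Poly_Mapping.lookup m i)"
    proof (rule sum_mono)
      fix i
      have "degree ([:A $ i, B $ i:] ^ Poly_Mapping.lookup m i) \<le> degree [:A $ i, B $ i:] * Poly_Mapping.lookup m i"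
        by (rule degree_power_le)
      also have "\<dots> \<le> 1 * Poly_Mapping.lookup m i"
        by (intro mult_right_mono) auto
      finally show "degree ([:A $ i, B $ i:] ^ Poly_Mapping.lookup m i) \<le> Poly_Mapping.lookup m i" by simp
    qed
    also have "\<dots> \<le> cpoly_degree p"
      unfolding cpoly_degree_def using m by (intro Max_ge) auto
    finally show "degree (smult (Poly_Mapping.lookup p m)
        (\<Prod>i\<in>UNIV. [:A $ i, B $ i:] ^ Poly_Mapping.lookup m i)) \<le> cpoly_degree p"
      by (meson degree_smult_le order_trans)
  qed simp
qed

lemma join_point_line: "join_point (A + s *s B) (a + s * b) = join_point A a + s *s join_point B b"
  by (simp add: join_point_def vec_eq_iff split: sum.split)

lemma holomorphic_cpoly_eval_join_point:
  assumes "g holomorphic_on S"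
  shows "(\<lambda>x. cpoly_eval p (join_point (x *s v) (g x))) holomorphic_on S"
proof -
  have "(\<lambda>x. join_point (x *s v) (g x) $ i) holomorphic_on S" for i
    unfolding join_point_def by (cases i) (auto intro!: holomorphic_intros assms)
  then show ?thesis unfolding cpoly_eval_def by (intro holomorphic_intros)
qed

lemma continuous_on_cpoly_eval_join_point:
  assumes "continuous_on S f"
  shows "continuous_on S (\<lambda>z. cpoly_eval p (join_point z (f z)))"
proof -
  have "continuous_on S (\<lambda>z. join_point z (f z) $ i)" for i
    unfolding join_point_def by (cases i) (auto intro!: continuous_intros assms)
  then show ?thesis unfolding cpoly_eval_def
    by (intro continuous_on_sum continuous_on_mult continuous_on_prod continuous_on_power continuous_on_const) auto
qed

text \<open>Replacing the function \<open>g\<close> by the constant \<open>b\<close> in a polynomial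
  changes it by a multiple of \<open>g - b\<close>. The relation \<open>R\<close> is congruence
  modulo \<open>g - b\<close>, compatible with sums and products. At the zeros of
  \<open>g - b\<close> the restriction of \<open>p\<close> to the line therefore interpolates its
  values on the graph.\<close>

lemma cpoly_eval_join_point_diff:
  assumes g: "g holomorphic_on S"
  obtains H where "H holomorphic_on S"
    "\<And>x. x \<in> S \<Longrightarrow> cpoly_eval p (join_point (x *s v) (g x)) =
        cpoly_eval p (join_point (x *s v) b) + (g x - b) * H x"
proof -
  define R where "R = (\<lambda>\<phi> \<psi>. \<phi> holomorphic_on S \<and> \<psi> holomorphic_on S \<and>
      (\<exists>H. H holomorphic_on S \<and> (\<forall>x\<in>S. \<phi> x = \<psi> x + (g x - b) * H x)))"
  have R_same: "R \<phi> \<phi>" if "\<phi> holomorphic_on S" for \<phi>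
    unfolding R_def using that by (auto intro!: exI[of _ "\<lambda>_. 0"])
  have R_gb: "R g (\<lambda>_. b)"
    unfolding R_def using g by (auto intro!: exI[of _ "\<lambda>_. 1"])
  have R_add: "R (\<lambda>x. \<phi> x + \<phi>' x) (\<lambda>x. \<psi> x + \<psi>' x)" if R: "R \<phi> \<psi>" "R \<phi>' \<psi>'" for \<phi> \<psi> \<phi>' \<psi>'
  proof -
    obtain H H' where H: "H holomorphic_on S" "\<forall>x\<in>S. \<phi> x = \<psi> x + (g x - b) * H x"
      "H' holomorphic_on S" "\<forall>x\<in>S. \<phi>' x = \<psi>' x + (g x - b) * H' x"
      using R unfolding R_def by blast
    show ?thesis unfolding R_def
      by (intro conjI exI[of _ "\<lambda>x. H x + H' x"])
        (use H R in \<open>auto simp: R_def algebra_simps intro!: holomorphic_intros\<close>)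
  qed
  have R_mult: "R (\<lambda>x. \<phi> x * \<phi>' x) (\<lambda>x. \<psi> x * \<psi>' x)" if R: "R \<phi> \<psi>" "R \<phi>' \<psi>'" for \<phi> \<psi> \<phi>' \<psi>'
  proof -
    obtain H H' where H: "H holomorphic_on S" "\<forall>x\<in>S. \<phi> x = \<psi> x + (g x - b) * H x"
      "H' holomorphic_on S" "\<forall>x\<in>S. \<phi>' x = \<psi>' x + (g x - b) * H' x"
      using R unfolding R_def by blast
    have "\<phi> x * \<phi>' x = \<psi> x * \<psi>' x + (g x - b) * (\<psi> x * H' x + H x * \<phi>' x)" if "x \<in> S" for x
    proof -
      have "\<phi> x * \<phi>' x = \<psi> x * \<phi>' x + (g x - b) * (H x * \<phi>' x)"
        by (simp only: H(2)[rule_format, OF that] distrib_right mult.assoc)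
      also have "\<psi> x * \<phi>' x = \<psi> x * \<psi>' x + (g x - b) * (\<psi> x * H' x)"
        unfolding H(4)[rule_format, OF that] by (simp add: algebra_simps)
      finally show ?thesis by (simp add: algebra_simps)
    qed
    then show ?thesis unfolding R_def
      by (intro conjI exI[of _ "\<lambda>x. \<psi> x * H' x + H x * \<phi>' x"])
        (use H R in \<open>auto simp: R_def intro!: holomorphic_intros\<close>)
  qed
  have R_power: "R (\<lambda>x. \<phi> x ^ n) (\<lambda>x. \<psi> x ^ n)" if "R \<phi> \<psi>" for \<phi> \<psi> n
    by (induction n) (use R_same[of "\<lambda>_. 1"] R_mult[OF that] in auto)
  have R_prod: "R (\<lambda>x. \<Prod>i\<in>I. \<phi> i x) (\<lambda>x. \<Prod>i\<in>I. \<psi> i x)"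
    if "finite I" "\<And>i. R (\<phi> i) (\<psi> i)" for I :: "('a + 1) set" and \<phi> \<psi>
    using that(1) by (induction I) (use R_same[of "\<lambda>_. 1"] R_mult[OF that(2)] in auto)
  have R_sum: "R (\<lambda>x. \<Sum>i\<in>I. \<phi> i x) (\<lambda>x. \<Sum>i\<in>I. \<psi> i x)"
    if "finite I" "\<And>i. R (\<phi> i) (\<psi> i)" for I :: "(('a + 1) \<Rightarrow>\<^sub>0 nat) set" and \<phi> \<psi>
    using that(1) by (induction I) (use R_same[of "\<lambda>_. 0"] R_add[OF that(2)] in auto)
  have "R (\<lambda>x. join_point (x *s v) (g x) $ i) (\<lambda>x. join_point (x *s v) b $ i)" for i
    unfolding join_point_def
    by (cases i) (auto intro!: R_gb R_same holomorphic_intros)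
  then have "R (\<lambda>x. cpoly_eval p (join_point (x *s v) (g x))) (\<lambda>x. cpoly_eval p (join_point (x *s v) b))"
    unfolding cpoly_eval_def
    by (intro R_sum R_mult R_prod R_power R_same[of "\<lambda>_. _"] finite_keys finite holomorphic_intros)
  then show thesis using that unfolding R_def by blast
qed

subsection \<open>Maximum modulus on balls\<close>

definition ball_max :: "(complex ^ 'n \<Rightarrow> complex) \<Rightarrow> real \<Rightarrow> real" where
  "ball_max h r = (SUP z\<in>cball 0 r. cmod (h z))"

lemma graph_max_vec:
  "graph_max (\<lambda>z. vec (f z) :: complex ^ 1) p r = ball_max (\<lambda>z. cpoly_eval p (join_point z (f z))) r"
  by (simp add: graph_max_def ball_max_def graph_point_vec)

lemma ball_max_upper:
  assumes "continuous_on UNIV h" "norm z \<le> r"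
  shows "cmod (h z) \<le> ball_max h r"
  unfolding ball_max_def
proof (rule cSUP_upper)
  have "compact ((\<lambda>z. cmod (h z)) ` cball 0 r)"
    by (intro compact_continuous_image continuous_intros continuous_on_subset[OF assms(1)]) auto
  then show "bdd_above ((\<lambda>z. cmod (h z)) ` cball 0 r)"
    by (intro bounded_imp_bdd_above compact_imp_bounded)
qed (use assms in auto)

lemma ball_max_least:
  assumes "r \<ge> 0" "\<And>z. norm z \<le> r \<Longrightarrow> cmod (h z) \<le> B"
  shows "ball_max h r \<le> B"
  unfolding ball_max_def by (rule cSUP_least) (use assms in auto)

lemma ball_max_attained:
  assumes "continuous_on UNIV h" "r \<ge> 0"
  obtains z where "norm z \<le> r" "cmod (h z) = ball_max h r"
proof -
  have "\<exists>z\<in>cball 0 r. \<forall>y\<in>cball 0 r. cmod (h y) \<le> cmod (h z)"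
    by (rule continuous_attains_sup)
      (use assms in \<open>auto intro!: continuous_intros continuous_on_subset[OF assms(1)]\<close>)
  then obtain z where z: "norm z \<le> r" "\<And>y. norm y \<le> r \<Longrightarrow> cmod (h y) \<le> cmod (h z)" by auto
  then show thesis
    using that[OF z(1)] ball_max_upper[OF assms(1) z(1)] ball_max_least[OF assms(2), of h "cmod (h z)"] z(2) by force
qed

lemma ball_max_nonneg: "continuous_on UNIV h \<Longrightarrow> r \<ge> 0 \<Longrightarrow> ball_max h r \<ge> 0"
  using ball_max_upper[of h 0 r] norm_ge_zero[of "h 0"] by (simp del: norm_ge_zero)

lemma ball_max_mono:
  assumes "continuous_on UNIV h" "0 \<le> r" "r \<le> R"
  shows "ball_max h r \<le> ball_max h R"
  by (rule ball_max_least) (use assms in \<open>auto intro!: ball_max_upper\<close>)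

text \<open>A maximum point spans a complex line through the origin, and the maximum principle in
  one variable moves it along this line to the boundary circle.\<close>

lemma ball_max_attained_sphere:
  fixes h :: "complex ^ 'n \<Rightarrow> complex"
  assumes "continuous_on UNIV h" "r \<ge> 0" "\<And>v. (\<lambda>x. h (x *s v)) holomorphic_on UNIV"
  obtains z where "norm z = r" "cmod (h z) = ball_max h r"
proof -
  obtain z where z: "norm z \<le> r" "cmod (h z) = ball_max h r"
    using ball_max_attained[OF assms(1,2)] by blast
  obtain v where v: "norm v = 1" "z = of_real (norm z) *s v"
  proof (cases "z = 0")
    case True
    show ?thesis
      by (rule that[of "axis undefined 1"]) (use True in \<open>simp_all add: norm_axis_1 vec_eq_iff\<close>)
  next
    case False
    show ?thesis
      by (rule that[of "of_real (inverse (norm z)) *s z"])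
        (use False in \<open>simp_all add: norm_cscale norm_divide norm_inverse flip: of_real_inverse of_real_mult\<close>)
  qed
  have "continuous_on (sphere 0 r) (\<lambda>x. cmod (h (x *s v)))"
    by (intro continuous_intros holomorphic_on_imp_continuous_on holomorphic_on_subset[OF assms(3)]) auto
  moreover have "sphere (0::complex) r \<noteq> {}" using assms(2) by simp
  ultimately obtain x where x: "cmod x = r" "\<And>y. cmod y = r \<Longrightarrow> cmod (h (y *s v)) \<le> cmod (h (x *s v))"
    using continuous_attains_sup[OF compact_sphere, of "0::complex" r "\<lambda>x. cmod (h (x *s v))"] by auto
  have "cmod (h (of_real (norm z) *s v)) \<le> cmod (h (x *s v))"
  proof (cases "r = 0")
    case True
    then show ?thesis using x z v by auto
  next
    case False
    show ?thesis
    proof (rule maximum_modulus_frontier[of "\<lambda>x. h (x *s v)" "cball 0 r"])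
      show "continuous_on (closure (cball 0 r)) (\<lambda>x. h (x *s v))"
        by (intro holomorphic_on_imp_continuous_on holomorphic_on_subset[OF assms(3)]) auto
    qed (use False x assms z in \<open>auto intro: holomorphic_on_subset[OF assms(3)]\<close>)
  qed
  then have "cmod (h (x *s v)) \<ge> ball_max h r" using v z by simp
  moreover have "norm (x *s v) = r" using x v by (simp add: norm_cscale)
  ultimately show thesis using that[of "x *s v"] ball_max_upper[OF assms(1), of "x *s v" r] by simp
qed

text \<open>The maximum principle for \<open>h (x v) / x\<^sup>N\<close> on an annulus.\<close>

lemma ball_max_div_power_le:
  fixes h :: "complex ^ 'n \<Rightarrow> complex"
  assumes h: "continuous_on UNIV h" "\<And>v. (\<lambda>x. h (x *s v)) holomorphic_on UNIV"
    and r: "0 < r" "r \<le> s" "s \<le> t"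
    and B: "ball_max h r \<le> B * r ^ N" "ball_max h t \<le> B * t ^ N"
  shows "ball_max h s \<le> B * s ^ N"
proof -
  obtain z where z: "norm z = s" "cmod (h z) = ball_max h s"
    using ball_max_attained_sphere[OF h(1) _ h(2), of s] r by auto
  define v where "v = of_real (inverse s) *s z"
  have v: "norm v = 1" "z = of_real s *s v"
    using z r by (simp_all add: v_def norm_cscale norm_inverse flip: of_real_inverse of_real_mult)
  have "cmod (h (of_real s *s v) / of_real s ^ N) \<le> B"
  proof (rule maximum_modulus_frontier[of "\<lambda>x. h (x *s v) / x ^ N" "cball 0 t - ball 0 r"])
    have nz: "x \<noteq> 0" if "x \<in> cball 0 t - ball 0 r" for x :: complex using that r by auto
    have hol: "(\<lambda>x. h (x *s v) / x ^ N) holomorphic_on cball 0 t - ball 0 r"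
      by (intro holomorphic_intros holomorphic_on_subset[OF h(2)]) (use nz in auto)
    show "(\<lambda>x. h (x *s v) / x ^ N) holomorphic_on interior (cball 0 t - ball 0 r)"
      by (rule holomorphic_on_subset[OF hol interior_subset])
    have cl: "closed (cball (0::complex) t - ball 0 r)" by (intro closed_Diff) auto
    show "continuous_on (closure (cball 0 t - ball 0 r)) (\<lambda>x. h (x *s v) / x ^ N)"
      unfolding closure_closed[OF cl] by (rule holomorphic_on_imp_continuous_on[OF hol])
    fix x :: complex assume "x \<in> frontier (cball 0 t - ball 0 r)"
    then have "x \<in> (cball 0 t - ball 0 r) - interior (cball 0 t - ball 0 r)"
      unfolding frontier_def closure_closed[OF cl] .
    moreover have "ball 0 t - cball 0 r \<subseteq> interior (cball (0::complex) t - ball 0 r)"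
      by (rule interior_maximal) (auto intro!: open_Diff)
    moreover have "x \<in> ball 0 t - cball 0 r" if "cmod x \<noteq> r" "cmod x \<noteq> t" "x \<in> cball 0 t - ball 0 r"
      using that by auto
    ultimately have "cmod x = r \<or> cmod x = t" by blast
    moreover have "cmod (h (x *s v)) \<le> ball_max h (cmod x)"
      by (rule ball_max_upper[OF h(1)]) (simp add: norm_cscale v)
    ultimately have "cmod (h (x *s v)) \<le> B * cmod x ^ N" using B by auto
    moreover have "cmod x > 0" using \<open>cmod x = r \<or> cmod x = t\<close> r by auto
    ultimately show "cmod (h (x *s v) / x ^ N) \<le> B"
      by (simp add: norm_divide norm_power divide_le_eq)
  qed (use r in \<open>auto intro: bounded_subset[of "cball 0 t"]\<close>)
  then show ?thesis using z v r by (simp add: norm_divide norm_power divide_le_eq)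
qed

text \<open>The quotient \<open>q\<close> of the maximum by the power \<open>N\<close> of the radius
  never exceeds the larger of its values at two enclosing radii. If \<open>q t < q s\<close>, then
  \<open>q s \<le> q r\<close>, since a rise from \<open>r\<close> to \<open>s\<close> could not be
  followed by a fall; hence also \<open>q R \<le> q r\<close>. Strictness in \<open>gr\<close>
  excludes the case where \<open>t\<close> is the larger end; the other alternative there covers a
  vanishing function.\<close>

lemma ball_max_slope:
  fixes h :: "complex ^ 'n \<Rightarrow> complex"
  assumes h: "continuous_on UNIV h" "\<And>v. (\<lambda>x. h (x *s v)) holomorphic_on UNIV"
    and r: "0 < r" "r < R" "R \<le> s" "s < t"
    and gr: "ball_max h t < (t / s) ^ N * ball_max h s \<or> ball_max h t \<le> 0"
  shows "ball_max h R \<le> (R / r) ^ N * ball_max h r"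
proof (cases "ball_max h t \<le> 0")
  case True
  have "ball_max h R \<le> ball_max h t" using r by (intro ball_max_mono h) auto
  moreover have "(R / r) ^ N * ball_max h r \<ge> 0" using r by (intro mult_nonneg_nonneg ball_max_nonneg h) auto
  ultimately show ?thesis using True by linarith
next
  case False
  then have gr': "ball_max h t < (t / s) ^ N * ball_max h s" using gr by blast
  define q where "q = (\<lambda>x. ball_max h x / x ^ N)"
  have q: "ball_max h x = q x * x ^ N" if "x > 0" for x using that by (simp add: q_def)
  have qts: "q t < q s"
    using gr' r by (simp add: q_def field_simps power_divide)
  have "ball_max h s \<le> max (q r) (q t) * s ^ N"
    by (rule ball_max_div_power_le[OF h, of r s t]) (use r q in \<open>auto simp: mult_right_mono\<close>)
  then have "q s \<le> max (q r) (q t)" using r by (simp add: q_def divide_le_eq)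
  then have qsr: "q s \<le> q r" using qts by auto
  have "ball_max h R \<le> max (q r) (q s) * R ^ N"
    by (rule ball_max_div_power_le[OF h, of r R s]) (use r q in \<open>auto simp: mult_right_mono\<close>)
  also have "max (q r) (q s) = q r" using qsr by simp
  finally show ?thesis using r by (simp add: q_def power_divide field_simps)
qed

subsection \<open>Polynomial growth\<close>

lemma cpoly_eval_superset:
  assumes "finite A" "Poly_Mapping.keys p \<subseteq> A"
  shows "cpoly_eval p x =
    (\<Sum>m\<in>A. Poly_Mapping.lookup p m * (\<Prod>i\<in>UNIV. (x $ i) ^ Poly_Mapping.lookup m i))"
  unfolding cpoly_eval_def
  by (rule sum.mono_neutral_left) (use assms in \<open>auto simp: in_keys_iff\<close>)

lemma polynomial_fun_add:
  assumes "polynomial_fun f" "polynomial_fun g"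
  shows "polynomial_fun (\<lambda>z. f z + g z)"
proof -
  obtain p q where pq: "\<And>z. f z = cpoly_eval p z" "\<And>z. g z = cpoly_eval q z"
    using assms unfolding polynomial_fun_def by blast
  define A where "A = Poly_Mapping.keys p \<union> Poly_Mapping.keys q"
  have A: "finite A" "Poly_Mapping.keys p \<subseteq> A" "Poly_Mapping.keys q \<subseteq> A" "Poly_Mapping.keys (p + q) \<subseteq> A"
    using Poly_Mapping.keys_add[of p q] by (auto simp: A_def)
  have "f z + g z = cpoly_eval (p + q) z" for z
    by (simp add: pq cpoly_eval_superset[OF A(1,2)] cpoly_eval_superset[OF A(1,3)]
        cpoly_eval_superset[OF A(1,4)] lookup_add sum.distrib distrib_right)
  then show ?thesis unfolding polynomial_fun_def by blast
qed

lemma polynomial_fun_monomial: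
  "polynomial_fun (\<lambda>z :: complex ^ 'n. c * (\<Prod>i\<in>UNIV. (z $ i) ^ Poly_Mapping.lookup m i))"
  unfolding polynomial_fun_def
proof (intro exI allI)
  fix z :: "complex ^ 'n"
  show "c * (\<Prod>i\<in>UNIV. (z $ i) ^ Poly_Mapping.lookup m i) = cpoly_eval (Poly_Mapping.single m c) z"
    by (subst cpoly_eval_superset[of "{m}"]) (auto simp: lookup_single)
qed

lemma polynomial_fun_const: "polynomial_fun (\<lambda>z :: complex ^ 'n. c)"
  using polynomial_fun_monomial[of c 0] by simp

lemma polynomial_fun_sum:
  assumes "\<And>m. m \<in> A \<Longrightarrow> polynomial_fun (f m)"
  shows "polynomial_fun (\<lambda>z. \<Sum>m\<in>A. f m z)"
  using assms
  by (induction A rule: infinite_finite_induct) (auto intro: polynomial_fun_const polynomial_fun_add)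

lemma polynomial_fun_coord_mult:
  assumes "polynomial_fun f"
  shows "polynomial_fun (\<lambda>z. z $ j * f z)"
proof -
  obtain p where p: "\<And>z. f z = cpoly_eval p z"
    using assms unfolding polynomial_fun_def by blast
  have "z $ j * f z = (\<Sum>m\<in>Poly_Mapping.keys p. Poly_Mapping.lookup p m *
      (\<Prod>i\<in>UNIV. (z $ i) ^ Poly_Mapping.lookup (m + Poly_Mapping.single j 1) i))" for z
  proof -
    have "(\<Prod>i\<in>UNIV. (z $ i) ^ Poly_Mapping.lookup (m + Poly_Mapping.single j 1) i) =
        z $ j * (\<Prod>i\<in>UNIV. (z $ i) ^ Poly_Mapping.lookup m i)" for m
    proof -
      have "(\<Prod>i\<in>UNIV. (z $ i) ^ Poly_Mapping.lookup (Poly_Mapping.single j (1::nat)) i) = z $ j"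
      proof -
        have "(\<Prod>i\<in>UNIV. (z $ i) ^ Poly_Mapping.lookup (Poly_Mapping.single j (1::nat)) i) =
            (\<Prod>i\<in>UNIV. if i = j then z $ i else 1)"
          by (intro prod.cong) (auto simp: lookup_single when_def)
        then show ?thesis by simp
      qed
      then show ?thesis by (simp add: lookup_add power_add prod.distrib)
    qed
    then show ?thesis by (simp add: p cpoly_eval_def sum_distrib_left mult_ac)
  qed
  then show ?thesis by (simp only:) (intro polynomial_fun_sum polynomial_fun_monomial)
qed

lemma polynomial_fun_poly_mult:
  assumes "polynomial_fun f"
  shows "polynomial_fun (\<lambda>z. poly L (z $ j) * f z)"
proof (induction L)
  case 0
  then show ?case using polynomial_fun_const[of 0] by simp
next
  case (pCons a L)
  have "polynomial_fun (\<lambda>z. a * f z)"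
  proof -
    obtain p where p: "\<And>z. f z = cpoly_eval p z"
      using assms unfolding polynomial_fun_def by blast
    have "(\<lambda>z. a * f z) = (\<lambda>z. \<Sum>m\<in>Poly_Mapping.keys p. (a * Poly_Mapping.lookup p m) *
        (\<Prod>i\<in>UNIV. (z $ i) ^ Poly_Mapping.lookup m i))"
      by (simp add: p cpoly_eval_def sum_distrib_left mult_ac)
    then show ?thesis by (simp only:) (intro polynomial_fun_sum polynomial_fun_monomial)
  qed
  from polynomial_fun_add[OF this polynomial_fun_coord_mult[OF pCons.IH, of j]]
  show ?case by (simp add: algebra_simps)
qed

text \<open>The weights in Lagrange interpolation at \<open>0, ..., D\<close> are polynomials in the
  evaluation point. This makes a function polynomial in a coordinate once its restrictions to the
  nodes are polynomial in the other coordinates.\<close>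

lemma lagrange_basis:
  fixes D :: nat
  obtains L :: "nat \<Rightarrow> complex poly"
  where "\<And>q c. degree q \<le> D \<Longrightarrow> poly q c = (\<Sum>j\<le>D. poly (L j) c * poly q (of_nat j))"
proof
  define L :: "nat \<Rightarrow> complex poly" where
    "L = (\<lambda>j. \<Prod>l\<in>{..D} - {j}. smult (inverse (of_nat j - of_nat l)) [:- of_nat l, 1:])"
  have degL: "degree (L j) \<le> D" if "j \<le> D" for j
  proof -
    have "degree (L j) \<le> (\<Sum>l\<in>{..D} - {j}. degree (smult (inverse (of_nat j - of_nat l :: complex)) [:- of_nat l, 1:]))"
      unfolding L_def by (rule degree_prod_sum_le[unfolded o_def]) simp
    also have "\<dots> \<le> (\<Sum>l\<in>{..D} - {j}. 1)"
      by (intro sum_mono) simp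
    also have "\<dots> = D" using that by simp
    finally show ?thesis .
  qed
  have L: "poly (L j) (of_nat i) = (if i = j then 1 else 0)" if "i \<le> D" for i j
  proof -
    have *: "poly (L j) (of_nat i) = (\<Prod>l\<in>{..D} - {j}. inverse (of_nat j - of_nat l) * (of_nat i - of_nat l))"
      by (simp add: L_def poly_prod algebra_simps)
    show ?thesis
    proof (cases "i = j")
      case True
      have "(\<Prod>l\<in>{..D} - {j}. inverse (of_nat j - of_nat l) * (of_nat j - of_nat l :: complex)) = 1"
        by (rule prod.neutral) (auto intro!: left_inverse)
      then show ?thesis using True * by simp
    next
      case False
      then have "i \<in> {..D} - {j}" using that by auto
      then have "(\<Prod>l\<in>{..D} - {j}. inverse (of_nat j - of_nat l) * (of_nat i - of_nat l :: complex)) = 0"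
        by (intro prod_zero) auto
      then show ?thesis using False * by simp
    qed
  qed
  fix q :: "complex poly" and c :: complex
  assume q: "degree q \<le> D"
  define r where "r = (\<Sum>j\<le>D. smult (poly q (of_nat j)) (L j))"
  have "q = r"
  proof (rule poly_eqI_degree[of "of_nat ` {..D}"])
    have card: "card (of_nat ` {..D} :: complex set) = Suc D"
      by (subst card_image) (auto simp: inj_on_def)
    show "degree q < card (of_nat ` {..D} :: complex set)" using q card by simp
    have "degree r \<le> D" unfolding r_def
      by (intro degree_sum_le) (auto intro: order_trans[OF degree_smult_le degL] degL)
    then show "degree r < card (of_nat ` {..D} :: complex set)" using card by simp
    fix x :: complex assume "x \<in> of_nat ` {..D}"
    then obtain i where i: "i \<le> D" "x = of_nat i" by auto
    then show "poly q x = poly r x"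
      by (simp add: r_def poly_sum L if_distrib cong: if_cong)
  qed
  then show "poly q c = (\<Sum>j\<le>D. poly (L j) c * poly q (of_nat j))"
    by (metis (no_types, lifting) mult.commute poly_smult poly_sum r_def sum.cong)
qed

text \<open>Liouville's theorem, one coordinate at a time. The induction is over the set
  \<open>I\<close> of free coordinates, the others being frozen at \<open>a\<close>; a new
  coordinate is freed by interpolating between \<open>D + 1\<close> frozen values of it.\<close>

lemma polynomial_growth_imp_polynomial_fun:
  fixes f :: "complex ^ 'n \<Rightarrow> complex"
  assumes f: "entire f" and gr: "\<And>z. norm z \<ge> A \<Longrightarrow> cmod (f z) \<le> C * norm z ^ D"
  shows "polynomial_fun f"
proof -
  obtain L :: "nat \<Rightarrow> complex poly"
    where L: "\<And>q c. degree q \<le> D \<Longrightarrow> poly q c = (\<Sum>j\<le>D. poly (L j) c * poly q (of_nat j))"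
    using lagrange_basis[of D] by blast
  have "polynomial_fun (\<lambda>z. f (\<chi> i. if i \<in> I then z $ i else a $ i))" if "finite I" for I a
    using that
  proof (induction I arbitrary: a)
    case empty
    show ?case by (simp add: polynomial_fun_const)
  next
    case (insert i I)
    define y where "y = (\<lambda>z c. \<chi> j. if j \<in> I then z $ j else if j = i then c else a $ j)"
    have y_line: "y z c = y z 0 + c *s axis i 1" for z c
      using insert.hyps by (auto simp: y_def vec_eq_iff axis_def)
    have interp: "f (y z c) = (\<Sum>j\<le>D. poly (L j) c * f (y z (of_nat j)))" for z c
    proof -
      define F where "F = (\<lambda>c. f (y z c))"
      have "(\<lambda>c. f (y z 0 + c *s axis i 1)) holomorphic_on UNIV"
        by (rule entire_imp_holomorphic_line[OF f])
      then have holF: "F holomorphic_on UNIV" unfolding F_def by (simp only: flip: y_line)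
      define N0 where "N0 = norm (y z 0)"
      \<comment> \<open>Once \<open>cmod c\<close> exceeds the norm of the remaining coordinates,
        the norm of the point is at most twice \<open>cmod c\<close>; hence the factor
        \<open>2 ^ D\<close>.\<close>
      have "cmod (F c) \<le> (\<bar>C\<bar> * 2 ^ D) * cmod c ^ D" if c: "max A N0 \<le> cmod c" for c
      proof -
        have "cmod c = cmod (y z c $ i)" using insert.hyps by (simp add: y_def)
        also have "\<dots> \<le> norm (y z c)" by (rule Finite_Cartesian_Product.norm_nth_le)
        finally have "cmod c \<le> norm (y z c)" .
        then have "cmod (F c) \<le> C * norm (y z c) ^ D" unfolding F_def using c by (intro gr) auto
        also have "\<dots> \<le> \<bar>C\<bar> * norm (y z c) ^ D" by (intro mult_right_mono) auto
        also have "\<dots> \<le> \<bar>C\<bar> * (2 * cmod c) ^ D"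
        proof (intro mult_left_mono power_mono)
          have "norm (y z c) \<le> N0 + norm (c *s (axis i 1 :: complex ^ 'n))"
            unfolding N0_def by (subst y_line) (rule norm_triangle_ineq)
          then show "norm (y z c) \<le> 2 * cmod c" using c by (simp add: norm_cscale norm_axis_1)
        qed auto
        finally show ?thesis by (simp add: power_mult_distrib mult_ac)
      qed
      then have F: "F c = (\<Sum>k\<le>D. (deriv ^^ k) F 0 / fact k * c ^ k)" for c
        by (rule Liouville_polynomial[OF holF])
      define q where "q = (\<Sum>k\<le>D. monom ((deriv ^^ k) F 0 / fact k) k)"
      have "poly q c = F c" for c by (subst F) (simp add: q_def poly_sum poly_monom)
      moreover have "degree q \<le> D" unfolding q_def
        by (intro degree_sum_le) (auto intro: order_trans[OF degree_monom_le])
      ultimately show ?thesis using L[of q c] by (simp add: F_def)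
    qed
    have "f (\<chi> j. if j \<in> insert i I then z $ j else a $ j) =
        (\<Sum>j\<le>D. poly (L j) (z $ i) * f (\<chi> l. if l \<in> I then z $ l else (\<chi> l. if l = i then of_nat j else a $ l) $ l))" for z
    proof -
      have "(\<chi> j. if j \<in> insert i I then z $ j else a $ j) = y z (z $ i)"
        using insert.hyps by (auto simp: y_def vec_eq_iff)
      moreover have "(\<chi> l. if l \<in> I then z $ l else (\<chi> l. if l = i then of_nat j else a $ l) $ l) = y z (of_nat j)" for j
        by (simp add: y_def vec_eq_iff)
      ultimately show ?thesis using interp[of z "z $ i"] by simp
    qed
    then show ?case
      by (simp only:) (intro polynomial_fun_sum polynomial_fun_poly_mult insert.IH)
  qed
  from this[of UNIV 0] show ?thesis by simp
qed

text \<open>If all unit increments of the logarithm of the maximum were eventually below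
  \<open>Y0\<close>, summing them would give polynomial growth of degree about
  \<open>Y0\<close>.\<close>

lemma large_increment:
  fixes f :: "complex ^ 'n \<Rightarrow> complex"
  assumes f: "entire f" "\<not> polynomial_fun f"
  shows "\<exists>y\<ge>x0. ball_max f (exp y) \<ge> 1 \<and> ball_max f (exp (y + 1)) \<ge> exp Y0 * ball_max f (exp y)"
proof -
  note cont = entire_imp_continuous_on[OF f(1), of UNIV]
  have unb: "\<exists>x1\<ge>x0. ball_max f (exp x1) \<ge> 1"
  proof (rule ccontr)
    assume "\<not> ?thesis"
    then have lt: "ball_max f (exp x) < 1" if "x \<ge> x0" for x using that by force
    have "polynomial_fun f"
    proof (rule polynomial_growth_imp_polynomial_fun[OF f(1), of "exp x0" 1 0])
      fix z :: "complex ^ 'n" assume z: "exp x0 \<le> norm z"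
      have "0 < norm z" using z exp_gt_zero[of x0] by linarith
      then have "x0 \<le> ln (norm z)" using z by (simp add: ln_ge_iff)
      then have "ball_max f (norm z) < 1" using lt[of "ln (norm z)"] \<open>0 < norm z\<close> by simp
      then show "cmod (f z) \<le> 1 * norm z ^ 0" using ball_max_upper[OF cont, of z "norm z"] by simp
    qed
    then show False using f by simp
  qed
  then obtain x1 where x1: "x1 \<ge> x0" "ball_max f (exp x1) \<ge> 1" by blast
  have ge1: "ball_max f (exp x) \<ge> 1" if "x \<ge> x1" for x
    using ball_max_mono[OF cont, of "exp x1" "exp x"] x1 that by simp
  show ?thesis
  proof (rule ccontr)
    assume "\<not> ?thesis"
    then have step: "ball_max f (exp (x + 1)) \<le> exp Y0 * ball_max f (exp x)" if "x \<ge> x1" for x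
      using ge1[OF that] that x1 by force
    define D where "D = nat \<lceil>Y0\<rceil>"
    define B where "B = ball_max f (exp x1)"
    have B: "B \<ge> 1" using x1 by (simp add: B_def)
    have Y0: "Y0 \<le> real D" by (simp add: D_def of_nat_ceiling)
    have iter: "ball_max f (exp (x1 + real n)) \<le> exp (real D * real n) * B" for n
    proof (induction n)
      case 0
      then show ?case by (simp add: B_def)
    next
      case (Suc n)
      have "ball_max f (exp (x1 + real (Suc n))) \<le> exp Y0 * ball_max f (exp (x1 + real n))"
        using step[of "x1 + real n"] by (simp add: add_ac)
      also have "\<dots> \<le> exp D * (exp (real D * real n) * B)"
        by (intro mult_mono Suc.IH ball_max_nonneg cont) (use Y0 B in auto)
      finally show ?case by (simp add: exp_add[symmetric] algebra_simps)
    qed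
    have "polynomial_fun f"
    proof (rule polynomial_growth_imp_polynomial_fun[OF f(1), of "exp x1" "exp (D * (1 - x1)) * B" D])
      fix z :: "complex ^ 'n" assume z: "exp x1 \<le> norm z"
      have pos: "0 < norm z" using z exp_gt_zero[of x1] by linarith
      have x1z: "x1 \<le> ln (norm z)" using z pos by (simp add: ln_ge_iff)
      \<comment> \<open>Rounding up the number of unit steps costs at most one more step, which is
        where \<open>exp (D * (1 - x1))\<close> comes from.\<close>
      define n where "n = nat \<lceil>ln (norm z) - x1\<rceil>"
      have n: "ln (norm z) - x1 \<le> real n" "real n \<le> ln (norm z) - x1 + 1"
        using x1z by (simp_all add: n_def of_nat_ceiling)
      have "norm z = exp (ln (norm z))" using pos by simp
      also have "\<dots> \<le> exp (x1 + real n)" using n by (subst exp_le_cancel_iff) linarith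
      finally have "cmod (f z) \<le> ball_max f (exp (x1 + real n))" by (rule ball_max_upper[OF cont])
      also have "\<dots> \<le> exp (real D * real n) * B" by (rule iter)
      also have "\<dots> \<le> exp (real D * (ln (norm z) - x1 + 1)) * B"
        using n B by (intro mult_right_mono) (auto intro!: mult_left_mono)
      also have "\<dots> = exp (D * (1 - x1)) * B * exp (real D * ln (norm z))"
        by (simp add: algebra_simps flip: exp_add)
      also have "exp (real D * ln (norm z)) = norm z ^ D"
        using pos by (simp add: exp_of_nat_mult)
      finally show "cmod (f z) \<le> exp (D * (1 - x1)) * B * norm z ^ D" by simp
    qed
    then show False using f by simp
  qed
qed

section \<open>Doubling on one scale\<close>

text \<open>A grid of \<open>N * (k + 1)\<close> equally spaced points of the interval from 1 to 2
  is cut into \<open>k + 1\<close> blocks of \<open>N\<close> points. A block of values taken at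
  most \<open>k\<close> times each would contradict the growth of \<open>g\<close>, so every block
  contributes one value, and values from different blocks keep the spacing of the grid.\<close>

lemma many_preimage_values:
  fixes g :: "complex \<Rightarrow> complex"
  assumes hol: "g holomorphic_on ball 0 R" and R: "R > 1" and \<rho>: "\<rho> > 0"
    and K: "\<And>z. cmod z \<le> 1 \<Longrightarrow> cmod (g z) \<le> K"
    and r0: "0 < r0" "r0 \<le> 1" "\<And>z. cmod z \<le> r0 \<Longrightarrow> cmod (g z) \<le> \<rho> / 2"
    and r: "cmod a < r" "r < 1"
    and Y: "cmod (g a) \<ge> \<rho> * exp Y" "Y \<ge> ln 4" and N: "N \<ge> 1"
    and large: "real N * Y > 2 / (r - cmod a) * (real N * (ln (5 * (real N * (real k + 1))) + real k * ln (1 / r0))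
        + 2 / (1 - r) * ln (2 * (K + 2 * \<rho>) / \<rho>))"
  shows "\<exists>w. \<forall>i\<le>k. cmod (w i) \<le> 2 \<and> has_roots_in_disc (\<lambda>z. g z - of_real \<rho> * w i) R (Suc k) \<and>
           (\<Prod>j<i. cmod (w i - w j)) \<ge> 1 / (real N * (real k + 1)) ^ k"
proof -
  define N' where "N' = real N * (real k + 1)"
  have N': "N' \<ge> 1" using N by (simp add: N'_def mult_ge1_I)
  define e :: "nat \<Rightarrow> complex" where "e = (\<lambda>n. of_real (1 + real n / N'))"
  have e_diff: "cmod (e m - e n) \<ge> 1 / N'" if "m \<noteq> n" for m n
  proof -
    have "e m - e n = of_real ((real m - real n) / N')" by (simp add: e_def diff_divide_distrib)
    then have "cmod (e m - e n) = \<bar>real m - real n\<bar> / N'" using N' by (simp only: norm_of_real) simp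
    moreover have "\<bar>real m - real n\<bar> \<ge> 1" using that by linarith
    ultimately show ?thesis using N' by (simp add: divide_right_mono)
  qed
  have e_norm: "1 \<le> cmod (e n) \<and> cmod (e n) \<le> 2" if "n < N * (k + 1)" for n
  proof -
    have "real n \<le> N'" using that unfolding N'_def by (metis less_imp_le of_nat_1 of_nat_add of_nat_le_iff of_nat_mult)
    then have "0 \<le> real n / N'" "real n / N' \<le> 1" using N' by simp_all
    then show ?thesis unfolding e_def norm_of_real by linarith
  qed
  have "\<exists>n. i * N \<le> n \<and> n < Suc i * N \<and> has_roots_in_disc (\<lambda>z. g z - of_real \<rho> * e n) R (Suc k)" if i: "i \<le> k" for i
  proof (rule ccontr)
    assume contra: "\<not> ?thesis"
    define W where "W = e ` {i * N..<Suc i * N}"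
    have inj: "inj e" unfolding inj_def using e_diff N' by (metis cancel_comm_monoid_add_class.diff_cancel divide_le_0_1_iff norm_zero not_one_le_zero order_trans)
    have card: "card W = N" unfolding W_def using card_image[of e] inj by (simp add: inj_on_def inj_def)
    have range: "n < N * (k + 1)" if "n < Suc i * N" for n
    proof -
      have "Suc i * N \<le> (k + 1) * N" using i by (intro mult_le_mono1) auto
      from less_le_trans[OF that this] show ?thesis by (simp only: mult.commute)
    qed
    have "real (card W) * Y \<le> 2 / (r - cmod a) * (real (card W) * (ln (5 / (1 / N')) + real k * ln (1 / r0))
        + 2 / (1 - r) * ln (2 * (K + 2 * \<rho>) / \<rho>))"
    proof (rule few_preimages_limit_growth[OF hol R \<rho> K r0 r Y])
      show "1 \<le> cmod w \<and> cmod w \<le> 2" if "w \<in> W" for w using that range by (auto simp: W_def intro!: e_norm)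
      show "1 / N' \<le> cmod (v - w)" if "v \<in> W" "w \<in> W" "v \<noteq> w" for v w
        using that by (auto simp: W_def intro!: e_diff)
      show "\<not> has_roots_in_disc (\<lambda>z. g z - of_real \<rho> * w) R (Suc k)" if "w \<in> W" for w
        using that contra by (auto simp: W_def)
    qed (use N' in \<open>auto simp: W_def\<close>)
    then show False using large card by (simp add: N'_def)
  qed
  then obtain n where n: "\<And>i. i \<le> k \<Longrightarrow> i * N \<le> n i" "\<And>i. i \<le> k \<Longrightarrow> n i < Suc i * N"
    "\<And>i. i \<le> k \<Longrightarrow> has_roots_in_disc (\<lambda>z. g z - of_real \<rho> * e (n i)) R (Suc k)" by metis
  have n_neq: "n i \<noteq> n j" if "j < i" "i \<le> k" for i j
  proof -
    have "n j < Suc j * N" using n(2)[of j] that by simp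
    also have "\<dots> \<le> i * N" using that by (intro mult_le_mono1) auto
    also have "\<dots> \<le> n i" using n(1) that by simp
    finally show ?thesis by simp
  qed
  show ?thesis
  proof (intro exI[of _ "\<lambda>i. e (n i)"] allI impI conjI)
    fix i assume i: "i \<le> k"
    have "n i < Suc i * N" using n(2)[OF i] .
    also have "\<dots> \<le> (k + 1) * N" using i by (intro mult_le_mono1) auto
    finally show "cmod (e (n i)) \<le> 2" using e_norm by (simp add: mult.commute)
    show "has_roots_in_disc (\<lambda>z. g z - of_real \<rho> * e (n i)) R (Suc k)" by (rule n(3)[OF i])
    have "(1 / N') ^ k \<le> (1 / N') ^ i" using N' i by (intro power_decreasing) auto
    also have "\<dots> = (\<Prod>j<i. 1 / N')" by simp
    also have "\<dots> \<le> (\<Prod>j<i. cmod (e (n i) - e (n j)))"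
      using N' e_diff n_neq i by (intro prod_mono) auto
    finally show "1 / (real N * (real k + 1)) ^ k \<le> (\<Prod>j<i. cmod (e (n i) - e (n j)))"
      by (simp add: N'_def power_divide)
  qed
qed

lemma one_minus_exp_neg_ge:
  fixes d :: real
  assumes "0 \<le> d" "d \<le> 1"
  shows "1 - exp (- d) \<ge> d / 2"
proof -
  have "exp d \<ge> 1 + d" by simp
  then have "exp (- d) \<le> 1 / (1 + d)" using assms by (simp add: exp_minus field_simps)
  also have "\<dots> \<le> 1 - d / 2" using assms by (simp add: field_simps power2_eq_square mult_left_le)
  finally show ?thesis by simp
qed

text \<open>Two interpolations at the point \<open>v'\<close> of radius about
  \<open>exp (y + 3 * d)\<close>: along the line through \<open>v'\<close>, at zeros of
  \<open>f - \<rho> * w i\<close>, to bound \<open>p\<close> at \<open>v'\<close> and height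
  \<open>\<rho> * w i\<close>; then in the last coordinate, over the \<open>k + 1\<close> heights,
  to reach \<open>c\<close>.\<close>

lemma value_bound_along_line:
  fixes f :: "complex ^ 'n \<Rightarrow> complex" and p :: "('n + 1) cpoly"
  defines "M \<equiv> ball_max f" and "P \<equiv> \<lambda>z. cpoly_eval p (join_point z (f z))"
  assumes f: "entire f" and deg: "cpoly_degree p \<le> k" and d: "0 < d" "d \<le> 1"
    and M0: "M (exp y) > 0" and N: "N \<ge> 1" and v: "norm v \<le> exp d"
    and fv: "cmod (f (of_real (exp (y + d)) *s v)) \<ge> M (exp (y + d)) / 2 ^ k"
    and Y: "Y = ln (M (exp (y + d)) / M (exp y)) - (real k + 1) * ln 2" "Y \<ge> ln 4"
    and large: "real N * Y > 12 / d * (real N * (ln (5 * (real N * (real k + 1))) + 4 * real k)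
        + 4 / d * ln ((M (exp (y + 4 * d)) + 4 * M (exp y)) / M (exp y)))"
  shows "cmod (cpoly_eval p (join_point (of_real (exp (y + 3 * d)) *s v) c)) \<le>
     (3 * (real N * (real k + 1)) ^ k * 4 ^ k) ^ k * (cmod c / (2 * M (exp y)) + 2) ^ k *
     ((1 + 4 / d) ^ k * ball_max P (exp (y + 5 * d)))"
proof -
  note cont = entire_imp_continuous_on[OF f, of UNIV]
  have contP: "continuous_on UNIV P" unfolding P_def by (rule continuous_on_cpoly_eval_join_point[OF cont])
  define v' where "v' = of_real (exp (y + 3 * d)) *s v"
  define \<rho> where "\<rho> = 2 * M (exp y)"
  have \<rho>: "\<rho> > 0" using M0 by (simp add: \<rho>_def)
  define g where "g = (\<lambda>x. f (x *s v'))"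
  define K where "K = M (exp (y + 4 * d))"
  have holg: "g holomorphic_on S" for S
    unfolding g_def using entire_imp_holomorphic_line[OF f, of 0 v'] by simp
  have nv': "norm v' \<le> exp (y + 4 * d)"
  proof -
    have "norm v' \<le> exp (y + 3 * d) * exp d" unfolding v'_def norm_cscale
      using v by simp
    also have "\<dots> = exp (y + 4 * d)" by (simp flip: exp_add)
    finally show ?thesis .
  qed
  have nxv': "norm (x *s v') \<le> exp (y + (4 + b) * d)" if "cmod x \<le> exp (b * d)" for x b
  proof -
    have "norm (x *s v') \<le> exp (b * d) * exp (y + 4 * d)"
      unfolding norm_cscale using that nv' by (intro mult_mono) auto
    then show ?thesis by (simp add: algebra_simps flip: exp_add)
  qed
  define R where "R = exp d + 1"
  have ed: "exp d \<ge> 1 + d" by simp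
  have R: "R > 1" "exp d < R" by (simp_all add: R_def)
  have MK: "M (exp y) \<le> K" unfolding K_def M_def using d by (intro ball_max_mono cont) auto
  have M1: "M (exp (y + d)) > 0"
    using M0 ball_max_mono[OF cont, of "exp y" "exp (y + d)"] d by (simp add: M_def)
  have "\<exists>w. \<forall>i\<le>k. cmod (w i) \<le> 2 \<and> has_roots_in_disc (\<lambda>z. g z - of_real \<rho> * w i) R (Suc k) \<and>
           (\<Prod>j<i. cmod (w i - w j)) \<ge> 1 / (real N * (real k + 1)) ^ k"
  \<comment> \<open>The line is scaled so that 1 is \<open>v'\<close> and the unit disc lies in the
    ball of radius \<open>exp (y + 4 * d)\<close>. Radius \<open>exp (- 4 * d)\<close> then falls
    into the ball of radius \<open>exp y\<close>, where \<open>f\<close> is at most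
    \<open>\<rho> / 2\<close>, and \<open>exp (- 2 * d)\<close> is the point where \<open>f\<close>
    is assumed large.\<close>
  proof (rule many_preimage_values[where K = K and ?r0.0 = "exp (- 4 * d)" and r = "exp (- d)"
        and a = "of_real (exp (- 2 * d))" and Y = Y])
    show "cmod (g z) \<le> K" if "cmod z \<le> 1" for z
      unfolding g_def K_def M_def using nxv'[of z 0] that by (intro ball_max_upper[OF cont]) simp
    show "cmod (g z) \<le> \<rho> / 2" if "cmod z \<le> exp (- 4 * d)" for z
    proof -
      have "cmod (g z) \<le> ball_max f (exp y)"
        unfolding g_def using nxv'[of z "-4"] that by (intro ball_max_upper[OF cont]) simp
      then show ?thesis by (simp add: \<rho>_def M_def)
    qed
    show "\<rho> * exp Y \<le> cmod (g (of_real (exp (- 2 * d))))"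
    proof -
      \<comment> \<open>Of these factors 2, \<open>k\<close> pay for the loss allowed in
        \<open>fv\<close> and one for the 2 in \<open>\<rho>\<close>.\<close>
      have "exp ((real k + 1) * ln 2) = (2::real) ^ Suc k"
        by (simp add: exp_of_nat_mult distrib_right exp_add mult.commute flip: of_nat_Suc)
      then have "exp Y = M (exp (y + d)) / M (exp y) / 2 ^ Suc k"
        using M0 M1 by (simp add: Y exp_diff)
      then have "\<rho> * exp Y = M (exp (y + d)) / 2 ^ k" using M0 by (simp add: \<rho>_def)
      moreover have "of_real (exp (- 2 * d)) *s v' = of_real (exp (y + d)) *s v"
      proof -
        have "exp (- 2 * d) * exp (y + 3 * d) = exp (y + d)" by (simp flip: exp_add)
        then show ?thesis unfolding v'_def vector_smult_assoc by (simp only: flip: of_real_mult)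
      qed
      ultimately show ?thesis using fv by (simp add: g_def)
    qed
    define X where "X = ln (2 * (K + 2 * \<rho>) / \<rho>)"
    have X: "X = ln ((K + 4 * M (exp y)) / M (exp y))"
    proof -
      have "2 * (K + 2 * \<rho>) / \<rho> = (K + 4 * M (exp y)) / M (exp y)"
        using M0 by (simp add: \<rho>_def field_simps)
      then show ?thesis by (simp add: X_def)
    qed
    have X0: "X \<ge> 0" unfolding X using M0 MK by (simp add: field_simps)
    define E where "E = real N * (ln (5 * (real N * (real k + 1))) + 4 * real k)"
    have NN: "1 * 1 \<le> real N * (real k + 1)" using N by (intro mult_mono) auto
    have E0: "E \<ge> 0" unfolding E_def using NN by (intro mult_nonneg_nonneg add_nonneg_nonneg) auto
    have d2: "1 - exp (- d) \<ge> d / 2" by (rule one_minus_exp_neg_ge) (use d in auto)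
    have e3: "exp (- d) \<ge> 1 / 3"
    proof -
      have "exp d \<le> exp 1" using d by simp
      also have "\<dots> \<le> 3" by (rule exp_le)
      finally show ?thesis by (simp add: exp_minus field_simps)
    qed
    \<comment> \<open>The two gaps \<open>1 - r\<close> and \<open>r - cmod a\<close> are of order
      \<open>d\<close>; this produces the constants \<open>4 / d\<close> and
      \<open>12 / d\<close>.\<close>
    have "exp (- d) - exp (- 2 * d) = exp (- d) * (1 - exp (- d))"
      by (simp add: algebra_simps flip: exp_add)
    also have "\<dots> \<ge> 1 / 3 * (d / 2)" using d d2 e3 by (intro mult_mono) auto
    finally have d6: "exp (- d) - exp (- 2 * d) \<ge> d / 6" by simp
    have C1: "2 / (1 - exp (- d)) \<le> 4 / d" using d d2 frac_le[of 2 2 "d / 2" "1 - exp (- d)"] by simp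
    have C2: "2 / (exp (- d) - exp (- 2 * d)) \<le> 12 / d"
      using d d6 frac_le[of 2 2 "d / 6" "exp (- d) - exp (- 2 * d)"] by simp
    have "real k * ln (1 / exp (- 4 * d)) \<le> real k * 4"
      using d by (intro mult_left_mono) (simp_all add: ln_div)
    then have "real N * (ln (5 * (real N * (real k + 1))) + real k * ln (1 / exp (- 4 * d))) \<le> E"
      unfolding E_def by (intro mult_left_mono) auto
    moreover have "2 / (1 - exp (- d)) * X \<le> 4 / d * X" using C1 X0 by (intro mult_right_mono)
    ultimately have "real N * (ln (5 * (real N * (real k + 1))) + real k * ln (1 / exp (- 4 * d)))
        + 2 / (1 - exp (- d)) * X \<le> E + 4 / d * X" by (rule add_mono)
    then have "2 / (exp (- d) - exp (- 2 * d)) * (real N * (ln (5 * (real N * (real k + 1))) +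
        real k * ln (1 / exp (- 4 * d))) + 2 / (1 - exp (- d)) * X) \<le>
        2 / (exp (- d) - exp (- 2 * d)) * (E + 4 / d * X)"
      using d by (intro mult_left_mono) auto
    also have "\<dots> \<le> 12 / d * (E + 4 / d * X)"
      using C2 E0 X0 d by (intro mult_right_mono add_nonneg_nonneg mult_nonneg_nonneg) auto
    also have "\<dots> < real N * Y" using large by (simp add: E_def X K_def)
    finally show "2 / (exp (- d) - cmod (of_real (exp (- 2 * d)))) * (real N * (ln (5 * (real N * (real k + 1))) +
        real k * ln (1 / exp (- 4 * d))) + 2 / (1 - exp (- d)) * ln (2 * (K + 2 * \<rho>) / \<rho>)) < real N * Y"
      by (simp add: X_def)
  qed (use holg R \<rho> d N Y in auto)
  then obtain w where w: "\<And>i. i \<le> k \<Longrightarrow> cmod (w i) \<le> 2"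
    "\<And>i. i \<le> k \<Longrightarrow> has_roots_in_disc (\<lambda>z. g z - of_real \<rho> * w i) R (Suc k)"
    "\<And>i. i \<le> k \<Longrightarrow> (\<Prod>j<i. cmod (w i - w j)) \<ge> 1 / (real N * (real k + 1)) ^ k" by blast
  define S where "S = ball_max P (exp (y + 5 * d))"
  have S0: "S \<ge> 0" unfolding S_def by (rule ball_max_nonneg[OF contP]) simp
  have wb: "cmod (cpoly_eval p (join_point v' (of_real \<rho> * w i))) \<le> (1 + 4 / d) ^ k * S" if i: "i \<le> k" for i
  proof -
    define b where "b = of_real \<rho> * w i"
    obtain zs H where zs: "set zs \<subseteq> ball 0 1" "length zs = Suc k" "H holomorphic_on ball 0 R"
      "\<And>z. z \<in> ball 0 R \<Longrightarrow> g z - b = (\<Prod>x\<leftarrow>zs. z - x) * H z"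
      using w(2)[OF i] unfolding has_roots_in_disc_def b_def by blast
    obtain H' where H': "H' holomorphic_on ball 0 R"
      "\<And>x. x \<in> ball 0 R \<Longrightarrow> cpoly_eval p (join_point (x *s v') (g x)) =
        cpoly_eval p (join_point (x *s v') b) + (g x - b) * H' x"
      using cpoly_eval_join_point_diff[OF holg] by blast
    obtain \<pi> where \<pi>: "degree \<pi> \<le> cpoly_degree p" "\<And>s. poly \<pi> s = cpoly_eval p (join_point 0 b + s *s join_point v' 0)"
      using cpoly_eval_line by blast
    have \<pi>': "poly \<pi> s = cpoly_eval p (join_point (s *s v') b)" for s
      using join_point_line[of 0 s v' b 0] by (simp add: \<pi>)
    \<comment> \<open>The maximum is taken on radius \<open>exp d\<close>, which the line maps into
      the ball of radius \<open>exp (y + 5 * d)\<close>; the argument 1 is the point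
      \<open>v'\<close> itself.\<close>
    have "cmod (poly \<pi> 1) \<le> (1 + 4 / (exp d - 1)) ^ (length zs - 1) * S"
    proof (rule newton_interpolant_bound)
      show "(\<lambda>x. cpoly_eval p (join_point (x *s v') (g x))) holomorphic_on ball 0 R"
        by (rule holomorphic_cpoly_eval_join_point[OF holg])
      show "(\<lambda>x. H x * H' x) holomorphic_on ball 0 R" by (intro holomorphic_intros zs H')
      show "cpoly_eval p (join_point (z *s v') (g z)) = poly \<pi> z + (\<Prod>x\<leftarrow>zs. z - x) * (H z * H' z)"
        if "cmod z < R" for z using H'(2)[of z] zs(4)[of z] that by (simp add: \<pi>')
      show "cmod (cpoly_eval p (join_point (z *s v') (g z))) \<le> S" if "cmod z \<le> exp d" for z
      proof -
        have "cmod (P (z *s v')) \<le> S"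
          unfolding S_def using nxv'[of z 1] that by (intro ball_max_upper[OF contP]) simp
        then show ?thesis by (simp add: P_def g_def)
      qed
    qed (use zs \<pi> deg d R in auto)
    also have "\<dots> \<le> (1 + 4 / d) ^ k * S"
    proof -
      have "4 / (exp d - 1) \<le> 4 / d" by (intro divide_left_mono mult_pos_pos) (use d ed in linarith)+
      then show ?thesis using zs S0 d by (auto intro!: mult_right_mono power_mono)
    qed
    finally show ?thesis by (simp add: \<pi>' b_def)
  qed
  obtain q where q: "degree q \<le> cpoly_degree p" "\<And>s. poly q s = cpoly_eval p (join_point v' 0 + s *s join_point 0 (of_real \<rho>))"
    using cpoly_eval_line by blast
  have q': "poly q s = cpoly_eval p (join_point v' (of_real \<rho> * s))" for s
    using join_point_line[of v' s 0 0 "of_real \<rho>"] by (simp add: q mult.commute)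
  have "cmod (poly q (c / of_real \<rho>)) \<le> (3 * (real N * (real k + 1)) ^ k * 4 ^ k) ^ k *
      (cmod (c / of_real \<rho>) + 2) ^ k * ((1 + 4 / d) ^ k * S)"
  proof (rule poly_interpolation_bound)
    have NN: "1 * 1 \<le> real N * (real k + 1)" using N by (intro mult_mono) auto
    then show "1 \<le> (real N * (real k + 1)) ^ k" by (intro one_le_power) simp
  qed (use q deg w wb in \<open>auto simp: q'\<close>)
  then show ?thesis using \<rho> unfolding q' by (simp add: v'_def S_def \<rho>_def norm_divide norm_mult)
qed

text \<open>For fixed \<open>z\<close>, the height \<open>c = f z\<close> is held constant and
  \<open>p\<close> is extrapolated in the first coordinates, from directions near one where
  \<open>f\<close> is maximal to the direction of \<open>z\<close>. The preceding lemma applies to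
  those nearby directions only.\<close>

lemma doubling_step:
  fixes f :: "complex ^ 'n \<Rightarrow> complex" and p :: "('n + 1) cpoly"
  defines "M \<equiv> ball_max f" and "P \<equiv> \<lambda>z. cpoly_eval p (join_point z (f z))"
  assumes f: "entire f" and deg: "cpoly_degree p \<le> k" and d: "0 < d" "d \<le> 1"
    and M0: "M (exp y) > 0" and N: "N \<ge> 1"
    and L: "L = ln (M (exp (y + 6 * d)) / M (exp y))"
    and Y: "Y = ln (M (exp (y + d)) / M (exp y)) - (real k + 1) * ln 2" "Y \<ge> ln 4"
    and large: "real N * Y > 12 / d * (real N * (ln (5 * (real N * (real k + 1))) + 4 * real k)
        + 4 / d * (ln 5 + L))"
  shows "ball_max P (exp (y + 6 * d)) \<le>
    (4050 * exp (2 * L) * (16 * (real N * (real k + 1))) ^ k / d\<^sup>2) ^ k * ball_max P (exp (y + 5 * d))"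
proof (rule ball_max_least)
  note cont = entire_imp_continuous_on[OF f, of UNIV]
  have contP: "continuous_on UNIV P" unfolding P_def by (rule continuous_on_cpoly_eval_join_point[OF cont])
  fix z :: "complex ^ 'n" assume z: "norm z \<le> exp (y + 6 * d)"
  have mono: "M (exp a) \<le> M (exp b)" if "a \<le> b" for a b
    unfolding M_def using that by (intro ball_max_mono cont) auto
  define N' where "N' = real N * (real k + 1)"
  have N': "N' \<ge> 1" using N unfolding N'_def by (intro mult_ge1_I) auto
  define M1 where "M1 = M (exp (y + d))"
  define M2 where "M2 = M (exp (y + 2 * d))"
  define M6 where "M6 = M (exp (y + 6 * d))"
  have ord: "M (exp y) \<le> M1" "M1 \<le> M2" "M2 \<le> M6" "M (exp (y + 4 * d)) \<le> M6"
    unfolding M1_def M2_def M6_def using d by (auto intro!: mono)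
  have eL: "exp L = M6 / M (exp y)" using ord M0 by (simp add: L M6_def)
  have eL1: "exp L \<ge> 1" unfolding eL using ord M0 by simp
  define S where "S = ball_max P (exp (y + 5 * d))"
  have S0: "S \<ge> 0" unfolding S_def by (rule ball_max_nonneg[OF contP]) simp
  define t where "t = (\<lambda>i :: real. exp (y + i * d))"
  have tpos: "t i > 0" for i by (simp add: t_def)
  have "\<And>v. (\<lambda>x. f (x *s v)) holomorphic_on UNIV"
    using entire_imp_holomorphic_line[OF f, of 0] by simp
  then obtain z1 where z1: "norm z1 = exp (y + d)" "cmod (f z1) = M1"
    using ball_max_attained_sphere[OF cont, of "exp (y + d)"] unfolding M1_def M_def by auto
  define v0 where "v0 = of_real (inverse (t 1)) *s z1"
  have v0: "norm v0 = 1" "of_real (t 1) *s v0 = z1"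
    using z1 tpos[of 1] by (simp_all add: v0_def norm_cscale t_def flip: of_real_mult of_real_inverse)
  \<comment> \<open>Chosen so that \<open>v0 + u\<close>, scaled by \<open>t 3\<close>, is
    \<open>z\<close>. The bound 28 is 27 for \<open>exp 3\<close> plus 1 for
    \<open>v0\<close>.\<close>
  define u where "u = of_real (inverse (t 3)) *s z - v0"
  have "norm u \<le> 28"
  proof -
    have "norm u \<le> norm (of_real (inverse (t 3)) *s z) + norm v0"
      unfolding u_def by (rule norm_triangle_ineq4)
    also have "norm (of_real (inverse (t 3)) *s z) \<le> inverse (t 3) * t 6"
      unfolding norm_cscale norm_of_real using z tpos[of 3] by (simp add: t_def)
    also have "inverse (t 3) * t 6 = exp (3 * d)" by (simp add: t_def flip: exp_minus exp_add)
    also have "\<dots> \<le> exp 3" using d by simp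
    also have "\<dots> = exp 1 ^ 3" by (simp flip: exp_of_nat_mult)
    also have "\<dots> \<le> (3::real) ^ 3" by (intro power_mono exp_le) auto
    finally show ?thesis using v0 by simp
  qed
  \<comment> \<open>Small enough that \<open>v s\<close> stays within
    \<open>1 + d \<le> exp d\<close> on the unit disc; the target \<open>z\<close> sits at the
    parameter \<open>1 / \<eta>\<close>.\<close>
  define \<eta> where "\<eta> = d / 28"
  have \<eta>: "\<eta> > 0" using d by (simp add: \<eta>_def)
  define v where "v = (\<lambda>s. v0 + s *s (of_real \<eta> *s u))"
  have v_le: "norm (v s) \<le> exp d" if "cmod s \<le> 1" for s
  proof -
    have "norm (v s) \<le> 1 + cmod s * (\<eta> * norm u)"
      unfolding v_def using norm_triangle_ineq[of v0 "s *s (of_real \<eta> *s u)"] v0 \<eta> by (simp add: norm_cscale norm_mult mult.assoc)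
    also have "\<dots> \<le> 1 + 1 * (\<eta> * 28)"
      using that \<open>norm u \<le> 28\<close> \<eta> by (intro add_left_mono mult_mono) auto
    also have "\<dots> \<le> exp d" by (simp add: \<eta>_def)
    finally show ?thesis .
  qed
  define \<phi> where "\<phi> = (\<lambda>s. f (of_real (t 1) *s v s))"
  have \<phi>0: "cmod (\<phi> 0) = M1" using z1 v0 by (simp add: \<phi>_def v_def)
  have hol\<phi>: "\<phi> holomorphic_on ball 0 2"
  proof -
    have "\<phi> = (\<lambda>s. f (of_real (t 1) *s v0 + s *s (of_real (t 1) *s (of_real \<eta> *s u))))"
      by (simp add: \<phi>_def v_def vector_add_ldistrib vector_smult_assoc mult_ac)
    then show ?thesis by (simp only: entire_imp_holomorphic_line[OF f])
  qed
  have \<phi>_le: "cmod (\<phi> s) \<le> M2" if "cmod s \<le> 1" for s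
    unfolding \<phi>_def M2_def M_def
  proof (rule ball_max_upper[OF cont])
    have "norm (of_real (t 1) *s v s) \<le> t 1 * exp d"
      unfolding norm_cscale using v_le[OF that] tpos[of 1] by simp
    then show "norm (of_real (t 1) *s v s) \<le> exp (y + 2 * d)" by (simp add: t_def add_ac flip: exp_add)
  qed
  have "\<phi> 0 \<noteq> 0" using \<phi>0 ord M0 by auto
  \<comment> \<open>The directions must meet two demands: \<open>f\<close> large on each of them, to
    have many solutions there, and enough mutual distance for interpolation. The weighted choice of
    points gives both.\<close>
  from leja_points[OF hol\<phi> _ this \<phi>_le, of "Suc k"]
  obtain s where s: "\<And>i. i < Suc k \<Longrightarrow> cmod (s i) = 1" "\<And>i. i < Suc k \<Longrightarrow> cmod (\<phi> (s i)) \<ge> M1 / 2 ^ i"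
    "\<And>i. i < Suc k \<Longrightarrow> (\<Prod>j<i. cmod (s i - s j)) \<ge> M1 / M2"
    unfolding \<phi>0 by auto
  define c where "c = f z"
  have c: "cmod c \<le> M6" unfolding c_def M6_def M_def by (rule ball_max_upper[OF cont z])
  have lnL: "ln ((M (exp (y + 4 * d)) + 4 * M (exp y)) / M (exp y)) \<le> ln 5 + L"
  proof -
    have "(M (exp (y + 4 * d)) + 4 * M (exp y)) / M (exp y) \<le> exp L + 4"
      using ord M0 by (simp add: eL field_simps)
    also have "\<dots> \<le> 5 * exp L" using eL1 by simp
    finally have "ln ((M (exp (y + 4 * d)) + 4 * M (exp y)) / M (exp y)) \<le> ln (5 * exp L)"
      using M0 mono[of y "y + 4 * d"] d by (subst ln_le_cancel_iff) auto
    then show ?thesis by (simp add: ln_mult)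
  qed
  have large': "real N * Y > 12 / d * (real N * (ln (5 * (real N * (real k + 1))) + 4 * real k)
        + 4 / d * ln ((M (exp (y + 4 * d)) + 4 * M (exp y)) / M (exp y)))"
    by (rule order_le_less_trans[OF _ large]) (use d lnL in \<open>intro mult_left_mono add_left_mono; simp\<close>)
  define B where "B = (3 * N' ^ k * 4 ^ k) ^ k * (M6 / (2 * M (exp y)) + 2) ^ k * ((1 + 4 / d) ^ k * S)"
  have vb: "cmod (cpoly_eval p (join_point (of_real (t 3) *s v (s i)) c)) \<le> B" if i: "i \<le> k" for i
  proof -
    have "M1 / 2 ^ k \<le> M1 / 2 ^ i" using ord M0 i by (intro divide_left_mono) (auto intro: power_increasing)
    then have "M1 / 2 ^ k \<le> cmod (f (of_real (exp (y + d)) *s v (s i)))"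
      using s(2)[of i] i by (simp add: \<phi>_def t_def)
    then have "cmod (cpoly_eval p (join_point (of_real (exp (y + 3 * d)) *s v (s i)) c)) \<le>
     (3 * (real N * (real k + 1)) ^ k * 4 ^ k) ^ k * (cmod c / (2 * M (exp y)) + 2) ^ k *
     ((1 + 4 / d) ^ k * ball_max P (exp (y + 5 * d)))"
      using value_bound_along_line[OF f deg d, of y N "v (s i)" Y c] M0 N v_le[of "s i"] s(1)[of i] i Y large'
      unfolding M_def P_def M1_def by simp
    also have "\<dots> \<le> B"
      unfolding B_def N'_def[symmetric] S_def[symmetric]
    proof (intro mult_right_mono mult_left_mono power_mono add_right_mono divide_right_mono)
      show "0 \<le> (1 + 4 / d) ^ k * S" using d S0 by simp
    qed (use c M0 N' in auto)
    finally show ?thesis by (simp add: t_def)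
  qed
  obtain q where q: "degree q \<le> cpoly_degree p" "\<And>x. poly q x =
      cpoly_eval p (join_point (of_real (t 3) *s v0) c + x *s join_point (of_real (t 3) *s (of_real \<eta> *s u)) 0)"
    using cpoly_eval_line by blast
  have q': "poly q x = cpoly_eval p (join_point (of_real (t 3) *s v x) c)" for x
    unfolding q v_def
    using join_point_line[of "of_real (t 3) *s v0" x "of_real (t 3) *s (of_real \<eta> *s u)" c 0]
    by (simp add: vector_add_ldistrib vector_smult_assoc mult_ac)
  have "cmod (poly q (of_real (1 / \<eta>))) \<le> (3 * (M2 / M1) * 4 ^ k) ^ k * (cmod (of_real (1 / \<eta>)) + 2) ^ k * B"
  proof (rule poly_interpolation_bound)
    show "1 \<le> M2 / M1" using ord M0 by simp
    show "1 / (M2 / M1) \<le> (\<Prod>j<i. cmod (s i - s j))" if "i \<le> k" for i using s(3)[of i] that by simp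
    show "cmod (s i) \<le> 2" if "i \<le> k" for i using s(1)[of i] that by simp
  qed (use q deg vb in \<open>auto simp: q'\<close>)
  moreover have "of_real (t 3) *s v (of_real (1 / \<eta>)) = z"
    using \<eta> tpos[of 3] by (simp add: v_def u_def vector_smult_assoc flip: of_real_mult of_real_inverse of_real_divide)
  ultimately have "cmod (P z) \<le> (3 * (M2 / M1) * 4 ^ k) ^ k * (1 / \<eta> + 2) ^ k * B"
    using \<eta> by (simp add: q' P_def c_def norm_divide)
  also have "\<dots> = ((3 * (M2 / M1) * 4 ^ k) * (1 / \<eta> + 2) * (3 * N' ^ k * 4 ^ k) * (M6 / (2 * M (exp y)) + 2) * (1 + 4 / d)) ^ k * S"
  proof -
    have "a1 ^ k * a2 ^ k * (a3 ^ k * a4 ^ k * (a5 ^ k * S)) = (a1 * a2 * a3 * a4 * a5) ^ k * S"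
      for a1 a2 a3 a4 a5 :: real by (simp add: power_mult_distrib)
    then show ?thesis unfolding B_def .
  qed
  \<comment> \<open>The five factors are the spread of directions, the extrapolation to
    \<open>1 / \<eta>\<close>, the spread of heights, the extrapolation to \<open>c\<close> and the
    interpolation on a line. Their numerical parts multiply to 4050.\<close>
  also have "\<dots> \<le> ((3 * exp L * 4 ^ k) * (30 / d) * (3 * N' ^ k * 4 ^ k) * (3 * exp L) * (5 / d)) ^ k * S"
  proof (intro mult_right_mono power_mono mult_mono S0)
    have "M2 / M1 \<le> M6 / M (exp y)" using ord M0 by (intro frac_le) auto
    then show "M2 / M1 \<le> exp L" by (simp add: eL)
    show "1 / \<eta> + 2 \<le> 30 / d" using d by (simp add: \<eta>_def field_simps)
    show "1 + 4 / d \<le> 5 / d" using d by (simp add: field_simps)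
    have "M6 / (2 * M (exp y)) = exp L / 2" by (simp add: eL)
    then show "M6 / (2 * M (exp y)) + 2 \<le> 3 * exp L" using eL1 by linarith
  qed (use d ord M0 \<eta> N' eL1 in auto)
  also have "(3 * exp L * 4 ^ k) * (30 / d) * (3 * N' ^ k * 4 ^ k) * (3 * exp L) * (5 / d) =
      4050 * exp (2 * L) * (16 * N') ^ k / d\<^sup>2"
  proof -
    have "exp (2 * L) = exp L * exp L" by (simp flip: exp_add)
    moreover have "(16 * N') ^ k = 4 ^ k * 4 ^ k * N' ^ k"
    proof -
      have "(16 * N') ^ k = (4 * 4 * N') ^ k" by simp
      then show ?thesis by (simp only: power_mult_distrib)
    qed
    moreover have "(3 * e * q) * (30 / d) * (3 * n * q) * (3 * e) * (5 / d) = 4050 * (e * e) * (q * q * n) / d\<^sup>2"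
      for e q n :: real by (simp add: power2_eq_square)
    ultimately show ?thesis by (simp only:)
  qed
  finally show "cmod (P z) \<le> (4050 * exp (2 * L) * (16 * (real N * (real k + 1))) ^ k / d\<^sup>2) ^ k * ball_max P (exp (y + 5 * d))"
    by (simp add: N'_def S_def)
qed simp

section \<open>Regular growth\<close>

text \<open>Borel's argument: otherwise one of the twelve subintervals of length \<open>d / 2\<close> of \<open>[y, y + 6d]\<close> has an
  increment at least \<open>2\<^sup>1\<^sup>/\<^sup>\<epsilon>\<close> times as large, and iterating makes \<open>\<phi>\<close> unbounded on a bounded interval.\<close>

lemma exists_regular_growth:
  fixes \<phi> :: "real \<Rightarrow> real"
  assumes mono: "\<And>x x'. x0 \<le> x \<Longrightarrow> x \<le> x' \<Longrightarrow> \<phi> x \<le> \<phi> x'"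
    and incr: "\<And>Y. \<exists>y\<ge>x0. \<phi> (y + 1) - \<phi> y \<ge> Y" and \<epsilon>: "0 < \<epsilon>" "\<epsilon> \<le> 1"
  shows "\<exists>y d. y \<ge> x0 \<and> 0 < d \<and> d \<le> 1 \<and> \<phi> (y + d) - \<phi> y \<ge> Y0 \<and>
    d \<ge> (\<phi> (y + d) - \<phi> y) powr (- \<epsilon>) \<and> \<phi> (y + 6 * d) - \<phi> y \<le> (\<phi> (y + d) - \<phi> y) powr (1 + \<epsilon>)"
proof (rule ccontr)
  assume contra: "\<not> ?thesis"
  define A where "A = max 1 (max Y0 ((12 * 2 powr (1 / \<epsilon>)) powr (1 / \<epsilon>)))"
  have A: "A \<ge> 1" "A \<ge> Y0" by (auto simp: A_def)
  have Ae: "G powr \<epsilon> \<ge> 12 * 2 powr (1 / \<epsilon>)" if "G \<ge> A" for G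
  proof -
    have "12 * 2 powr (1 / \<epsilon>) = ((12 * 2 powr (1 / \<epsilon>)) powr (1 / \<epsilon>)) powr \<epsilon>"
      using \<epsilon> by (simp add: powr_powr)
    also have "\<dots> \<le> G powr \<epsilon>" using that \<epsilon> by (intro powr_mono2) (auto simp: A_def)
    finally show ?thesis .
  qed
  obtain y0 where y0: "y0 \<ge> x0" "\<phi> (y0 + 1) - \<phi> y0 \<ge> A" using incr by blast
  \<comment> \<open>The increment \<open>A * 2 powr (i / \<epsilon>)\<close> on length
    \<open>1 / 2 ^ i\<close> is tuned so that the lower bound required of \<open>d\<close> holds
    automatically. The base points drift by at most \<open>6 / 2 ^ i\<close> at stage
    \<open>i\<close>, hence by less than 12 in total.\<close>
  have step: "\<exists>y. y0 \<le> y \<and> y \<le> y0 + 12 - 12 / 2 ^ i \<and> \<phi> (y + 1 / 2 ^ i) - \<phi> y \<ge> A * 2 powr (real i / \<epsilon>)" for i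
  proof (induction i)
    case 0
    then show ?case using y0 by (intro exI[of _ y0]) auto
  next
    case (Suc i)
    then obtain y where y: "y0 \<le> y" "y \<le> y0 + 12 - 12 / 2 ^ i"
      "\<phi> (y + 1 / 2 ^ i) - \<phi> y \<ge> A * 2 powr (real i / \<epsilon>)" by blast
    define d :: real where "d = 1 / 2 ^ i"
    define G where "G = \<phi> (y + d) - \<phi> y"
    have d: "0 < d" "d \<le> 1" by (simp_all add: d_def)
    have G: "G \<ge> A * 2 powr (real i / \<epsilon>)" using y by (simp add: G_def d_def)
    have "1 \<le> 2 powr (real i / \<epsilon>)" using \<epsilon> by (simp add: ge_one_powr_ge_zero)
    then have "A * 1 \<le> A * 2 powr (real i / \<epsilon>)" using A by (intro mult_left_mono) auto
    then have GA: "G \<ge> A" using G by simp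
    have "2 powr (real i / \<epsilon>) \<le> A * 2 powr (real i / \<epsilon>)" using A by (simp add: mult_le_cancel_right1)
    then have "2 powr (real i / \<epsilon>) \<le> G" using G by linarith
    then have "(2 powr (real i / \<epsilon>)) powr \<epsilon> \<le> G powr \<epsilon>" using \<epsilon> by (intro powr_mono2) auto
    then have "2 ^ i \<le> G powr \<epsilon>" using \<epsilon> by (simp add: powr_powr powr_realpow)
    then have dG: "d \<ge> G powr (- \<epsilon>)" using GA A by (simp add: d_def powr_minus field_simps)
    \<comment> \<open>All other requirements hold at this \<open>y\<close> and \<open>d\<close>, so
      the contrary assumption can only fail the upper bound.\<close>
    have "\<not> \<phi> (y + 6 * d) - \<phi> y \<le> G powr (1 + \<epsilon>)"
    proof
      assume *: "\<phi> (y + 6 * d) - \<phi> y \<le> G powr (1 + \<epsilon>)"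
      have "y \<ge> x0" "G \<ge> Y0" using y y0 GA A by auto
      then show False using contra d dG * unfolding G_def by blast
    qed
    moreover have "G powr (1 + \<epsilon>) \<ge> 12 * (2 powr (1 / \<epsilon>) * G)"
      using Ae[OF GA] GA A mult_right_mono[OF Ae[OF GA], of G] by (simp add: powr_add mult_ac)
    ultimately have big: "\<phi> (y + 6 * d) - \<phi> y > 12 * (2 powr (1 / \<epsilon>) * G)" by linarith
    have "\<exists>m<12. \<phi> (y + real (Suc m) * (d / 2)) - \<phi> (y + real m * (d / 2)) \<ge> 2 powr (1 / \<epsilon>) * G"
    proof (rule ccontr)
      assume "\<not> ?thesis"
      then have "(\<Sum>m<12. \<phi> (y + real (Suc m) * (d / 2)) - \<phi> (y + real m * (d / 2))) \<le> (\<Sum>m<(12::nat). 2 powr (1 / \<epsilon>) * G)"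
        by (intro sum_mono) force
      also have "(\<Sum>m<12. \<phi> (y + real (Suc m) * (d / 2)) - \<phi> (y + real m * (d / 2))) = \<phi> (y + 6 * d) - \<phi> y"
        by (subst sum_lessThan_telescope) simp
      finally show False using big by simp
    qed
    then obtain m where m: "m < 12" "\<phi> (y + real (Suc m) * (d / 2)) - \<phi> (y + real m * (d / 2)) \<ge> 2 powr (1 / \<epsilon>) * G"
      by blast
    show ?case
    proof (intro exI[of _ "y + real m * (d / 2)"] conjI)
      show "y0 \<le> y + real m * (d / 2)" using y d by (simp add: add_increasing2)
      have "real m * (d / 2) \<le> 12 * (d / 2)" using m d by (intro mult_right_mono) auto
      then show "y + real m * (d / 2) \<le> y0 + 12 - 12 / 2 ^ Suc i" using y by (simp add: d_def)
      have "A * 2 powr (real (Suc i) / \<epsilon>) = 2 powr (1 / \<epsilon>) * (A * 2 powr (real i / \<epsilon>))"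
        by (simp add: add_divide_distrib powr_add mult_ac)
      also have "\<dots> \<le> 2 powr (1 / \<epsilon>) * G" using G by (intro mult_left_mono) auto
      also have "\<dots> \<le> \<phi> (y + real m * (d / 2) + 1 / 2 ^ Suc i) - \<phi> (y + real m * (d / 2))"
      proof -
        have "y + real m * (d / 2) + 1 / 2 ^ Suc i = y + real (Suc m) * (d / 2)"
          by (simp add: d_def add_divide_distrib distrib_right)
        then show ?thesis using m by (simp only:)
      qed
      finally show "A * 2 powr (real (Suc i) / \<epsilon>) \<le> \<phi> (y + real m * (d / 2) + 1 / 2 ^ Suc i) - \<phi> (y + real m * (d / 2))" .
    qed
  qed
  obtain i :: nat where i: "real i > \<phi> (y0 + 13) - \<phi> y0" using reals_Archimedean2 by blast
  obtain y where y: "y0 \<le> y" "y \<le> y0 + 12 - 12 / 2 ^ i" "\<phi> (y + 1 / 2 ^ i) - \<phi> y \<ge> A * 2 powr (real i / \<epsilon>)"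
    using step by blast
  have "y + 1 / 2 ^ i \<le> y0 + 13"
  proof -
    have "1 / 2 ^ i \<le> 12 / (2 :: real) ^ i" by (simp add: divide_right_mono)
    then show ?thesis using y by linarith
  qed
  then have "\<phi> (y + 1 / 2 ^ i) \<le> \<phi> (y0 + 13)" using y y0 by (intro mono) (auto intro: add_nonneg_nonneg order_trans)
  moreover have "\<phi> y0 \<le> \<phi> y" using y y0 by (intro mono) auto
  moreover have "real i \<le> A * 2 powr (real i / \<epsilon>)"
  proof -
    have "real i \<le> 2 ^ i" using of_nat_less_two_power[of i, where 'a = real] by simp
    also have "\<dots> = 2 powr real i" by (simp add: powr_realpow)
    also have "\<dots> \<le> 2 powr (real i / \<epsilon>)" using \<epsilon> mult_right_mono[of \<epsilon> 1 "real i"]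
      by (intro powr_mono) (simp_all add: field_simps)
    also have "\<dots> \<le> A * 2 powr (real i / \<epsilon>)" using A by (simp add: mult_le_cancel_right1)
    finally show ?thesis .
  qed
  ultimately show False using i y by linarith
qed

text \<open>The choice \<open>k \<approx> G\<^sup>1\<^sup>-\<^sup>2\<^sup>\<epsilon>\<close> and \<open>N \<approx> G\<^sup>4\<^sup>\<epsilon>\<close>, where \<open>\<epsilon> = \<delta> / 10\<close>.\<close>

lemma doubling_parameters:
  fixes \<delta> :: real and j :: nat
  assumes \<delta>: "0 < \<delta>" "\<delta> \<le> 1"
  shows "\<exists>G0. \<forall>G\<ge>G0. \<exists>k N :: nat. k \<ge> j \<and> N \<ge> 1 \<and>
    (\<forall>d L. G powr (- (\<delta> / 10)) \<le> d \<longrightarrow> d \<le> 1 \<longrightarrow> 0 < d \<longrightarrow> L \<le> G powr (1 + \<delta> / 10) \<longrightarrow>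
      G - (real k + 1) * ln 2 \<ge> ln 4 \<and>
      12 / d * (real N * (ln (5 * (real N * (real k + 1))) + 4 * real k) + 4 / d * (ln 5 + L))
        < real N * (G - (real k + 1) * ln 2) \<and>
      (real k * (ln 4050 + 2 * L + real k * ln (16 * (real N * (real k + 1))) + 2 * ln (1 / d)) + 1) / d + 1
        \<le> real k powr (2 + \<delta>))"
proof -
  define \<epsilon> where "\<epsilon> = \<delta> / 10"
  have \<epsilon>: "0 < \<epsilon>" "\<epsilon> \<le> 1 / 10" using \<delta> by (auto simp: \<epsilon>_def)
  have "eventually (\<lambda>G :: real. G \<ge> 4050) at_top" by real_asymp
  moreover have "eventually (\<lambda>G :: real. ln 64 + 2 * ln G \<le> G powr \<epsilon>) at_top"
    using \<epsilon> by real_asymp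
  moreover have "eventually (\<lambda>G :: real. G powr \<epsilon> \<ge> 400) at_top"
    using \<epsilon> by real_asymp
  moreover have "eventually (\<lambda>G :: real. G powr (1 - 2 * \<epsilon>) \<ge> real (j + 2)) at_top"
    using \<epsilon> by real_asymp
  ultimately have "eventually (\<lambda>G :: real. G \<ge> 4050 \<and> ln 64 + 2 * ln G \<le> G powr \<epsilon> \<and>
      G powr \<epsilon> \<ge> 400 \<and> G powr (1 - 2 * \<epsilon>) \<ge> real (j + 2)) at_top"
    by eventually_elim auto
  then obtain G0 where G0: "\<And>G. G \<ge> G0 \<Longrightarrow> G \<ge> 4050 \<and> ln 64 + 2 * ln G \<le> G powr \<epsilon> \<and>
      G powr \<epsilon> \<ge> 400 \<and> G powr (1 - 2 * \<epsilon>) \<ge> real (j + 2)"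
    unfolding eventually_at_top_linorder by blast
  show ?thesis
  proof (intro exI[of _ G0] allI impI)
    fix G assume "G0 \<le> G"
    from G0[OF this] have G: "G \<ge> 4050" "ln 64 + 2 * ln G \<le> G powr \<epsilon>" "G powr \<epsilon> \<ge> 400"
      "G powr (1 - 2 * \<epsilon>) \<ge> real (j + 2)" by auto
    define k where "k = nat \<lfloor>G powr (1 - 2 * \<epsilon>)\<rfloor>"
    define N where "N = nat \<lceil>G powr (4 * \<epsilon>)\<rceil>"
    \<comment> \<open>All quantities are measured by \<open>x\<close> and \<open>h\<close>, with
      \<open>G = h * x\<^sup>2\<close>: then \<open>k\<close> is about \<open>h\<close>,
      \<open>N\<close> about \<open>x ^ 4\<close>, \<open>1 / d \<le> x\<close> and
      \<open>L \<le> G * x\<close>.\<close>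
    define x where "x = G powr \<epsilon>"
    define h where "h = G powr (1 - 2 * \<epsilon>)"
    have x: "x \<ge> 400" "ln 64 + 2 * ln G \<le> x" using G by (auto simp: x_def)
    have h2: "h \<ge> real j + 2" using G by (simp add: h_def)
    have hx2: "h * x\<^sup>2 = G"
      using G by (simp add: h_def x_def power2_eq_square flip: powr_add)
    have xh: "x \<le> h" unfolding x_def h_def using G \<epsilon> by (intro powr_mono) auto
    have Gx4: "G powr (4 * \<epsilon>) = x ^ 4"
      by (simp add: x_def powr_powr mult.commute flip: powr_numeral)
    have k: "real k \<le> h" "h - 1 \<le> real k" using h2 by (auto simp: k_def h_def)
    have kh: "h / 2 \<le> real k" "k \<ge> j" "k \<ge> 1" using k h2 by auto
    have N: "x ^ 4 \<le> real N" "real N \<le> x ^ 4 + 1" "N \<ge> 1"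
    proof -
      show 1: "x ^ 4 \<le> real N" "real N \<le> x ^ 4 + 1"
        unfolding N_def Gx4 using x by (auto simp: of_nat_ceiling)
      have "x ^ 4 \<ge> 1" using x by (intro one_le_power) auto
      then show "N \<ge> 1" using 1 by linarith
    qed
    have lnN: "ln (16 * (real N * (real k + 1))) \<le> x"
    proof -
      have "x ^ 4 \<ge> 1" using x by (intro one_le_power) auto
      have "real N * (real k + 1) \<le> (2 * x ^ 4) * (2 * h)"
        using N k h2 \<open>x ^ 4 \<ge> 1\<close> by (intro mult_mono) auto
      also have "\<dots> = 4 * (x\<^sup>2 * G)" by (simp add: hx2[symmetric] power2_eq_square power4_eq_xxxx)
      also have "x\<^sup>2 \<le> G"
      proof -
        have "1 * x\<^sup>2 \<le> h * x\<^sup>2" using h2 by (intro mult_right_mono) auto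
        then show ?thesis using hx2 by simp
      qed
      then have "4 * (x\<^sup>2 * G) \<le> 4 * (G * G)" using G by (intro mult_left_mono mult_right_mono) auto
      finally have "16 * (real N * (real k + 1)) \<le> 64 * (G * G)" by simp
      then have "ln (16 * (real N * (real k + 1))) \<le> ln (64 * (G * G))"
        using N G by (subst ln_le_cancel_iff) auto
      also have "\<dots> = ln 64 + 2 * ln G" using G by (simp add: ln_mult)
      finally show ?thesis using x by linarith
    qed
    have lnN5: "ln (5 * (real N * (real k + 1))) \<le> x"
    proof -
      have "ln (5 * (real N * (real k + 1))) \<le> ln (16 * (real N * (real k + 1)))"
        using N by (subst ln_le_cancel_iff) auto
      then show ?thesis using lnN by linarith
    qed
    have G16: "G = h * x\<^sup>2" by (simp add: hx2)
    have x2: "x\<^sup>2 \<ge> 160000" using power_mono[OF x(1), of 2] by simp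
    have ln2: "(real k + 1) * ln 2 \<le> G / 4"
    proof -
      have "(real k + 1) * ln 2 \<le> (real k + 1) * 1"
        using ln_2_less_1 by (intro mult_left_mono) auto
      also have "\<dots> \<le> h + h" using k h2 by simp
      also have "\<dots> \<le> h * x\<^sup>2 / 4" using x2 h2 by simp
      finally show ?thesis by (simp add: hx2)
    qed
    have Y: "G - (real k + 1) * ln 2 \<ge> G / 2" using ln2 G by simp
    have ln4: "ln 4 \<le> (4 :: real)" using ln_le_minus_one[of 4] by simp
    have ln5: "ln 5 \<le> (5 :: real)" using ln_le_minus_one[of 5] by simp
    have ln4050: "ln 4050 \<le> G" using ln_le_minus_one[of 4050] G by simp
    have G1e: "G powr (1 + \<epsilon>) = G * x" using G by (simp add: x_def powr_add)
    show "\<exists>k N :: nat. k \<ge> j \<and> N \<ge> 1 \<and>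
      (\<forall>d L. G powr (- (\<delta> / 10)) \<le> d \<longrightarrow> d \<le> 1 \<longrightarrow> 0 < d \<longrightarrow> L \<le> G powr (1 + \<delta> / 10) \<longrightarrow>
        G - (real k + 1) * ln 2 \<ge> ln 4 \<and>
        12 / d * (real N * (ln (5 * (real N * (real k + 1))) + 4 * real k) + 4 / d * (ln 5 + L))
          < real N * (G - (real k + 1) * ln 2) \<and>
        (real k * (ln 4050 + 2 * L + real k * ln (16 * (real N * (real k + 1))) + 2 * ln (1 / d)) + 1) / d + 1
          \<le> real k powr (2 + \<delta>))"
    proof (rule exI[of _ k], rule exI[of _ N], intro conjI allI impI)
      fix d L assume "G powr (- (\<delta> / 10)) \<le> d" and d1: "d \<le> 1" and d0: "0 < d" and "L \<le> G powr (1 + \<delta> / 10)"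
      then have dx: "1 / d \<le> x" and L: "L \<le> G * x"
        using G1e x by (simp_all add: \<epsilon>_def[symmetric] powr_minus x_def[symmetric] field_simps)
      show "G - (real k + 1) * ln 2 \<ge> ln 4" using Y ln4 G by linarith
      have xG: "x * h \<le> G" "x \<le> G"
      proof -
        have "x * h * 1 \<le> x * h * x" using x h2 by (intro mult_left_mono) auto
        then show "x * h \<le> G" by (simp add: G16 power2_eq_square mult_ac)
        have "x * 1 \<le> x * h" using x h2 by (intro mult_left_mono) auto
        then show "x \<le> G" using \<open>x * h \<le> G\<close> by simp
      qed
      have L5: "ln 5 + L \<le> 2 * (G * x)"
      proof -
        have "G * 1 \<le> G * x" using x G by (intro mult_left_mono) auto
        then show ?thesis using ln5 L G by linarith
      qed
      show "12 / d * (real N * (ln (5 * (real N * (real k + 1))) + 4 * real k) + 4 / d * (ln 5 + L))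
          < real N * (G - (real k + 1) * ln 2)"
      proof -
        have a: "real N * (ln (5 * (real N * (real k + 1))) + 4 * real k) \<le> real N * (5 * h)"
          using lnN5 k xh by (intro mult_left_mono) auto
        have b: "4 / d * (ln 5 + L) \<le> (4 * x) * (2 * (G * x))"
        proof -
          have "4 / d * (ln 5 + L) \<le> 4 / d * (2 * (G * x))" using L5 d0 by (intro mult_left_mono) auto
          also have "\<dots> \<le> (4 * x) * (2 * (G * x))" using dx G x by (intro mult_right_mono) auto
          finally show ?thesis .
        qed
        \<comment> \<open>The single exceptional cost. It has size \<open>x ^ 4 * h\<close>, so
          \<open>N\<close> of size \<open>x ^ 4\<close> brings its share per value down to the size
          of \<open>k\<close>.\<close>
        have c: "(4 * x) * (2 * (G * x)) = 8 * (x ^ 4 * h)"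
          by (simp add: G16 power2_eq_square power4_eq_xxxx)
        have c': "8 * (x ^ 4 * h) \<le> real N * (8 * h)" using N h2 by simp
        have "12 / d * (real N * (ln (5 * (real N * (real k + 1))) + 4 * real k) + 4 / d * (ln 5 + L))
            \<le> 12 / d * (real N * (13 * h))"
          using a b c c' d0 by (intro mult_left_mono) (auto simp: algebra_simps)
        also have "\<dots> \<le> (12 * x) * (real N * (13 * h))"
          using dx h2 by (intro mult_right_mono) auto
        also have "\<dots> = real N * (156 * (x * h))" by simp
        also have "\<dots> < real N * (G / 2)"
        proof (intro mult_strict_left_mono)
          have "x * h * 400 \<le> x * h * x" using x h2 by (intro mult_left_mono) auto
          moreover have "x * h > 0" using x h2 by (intro mult_pos_pos) auto
          ultimately show "156 * (x * h) < G / 2" by (simp add: G16 power2_eq_square mult_ac)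
        qed (use N in auto)
        also have "\<dots> \<le> real N * (G - (real k + 1) * ln 2)" using Y by (intro mult_left_mono) auto
        finally show ?thesis .
      qed
      define B where "B = real k * (ln 4050 + 2 * L + real k * ln (16 * (real N * (real k + 1))) + 2 * ln (1 / d))"
      have GGx: "G \<le> G * x" using x G by (simp add: mult_le_cancel_left1)
      have Bk: "B \<le> real k * (6 * (G * x))"
        unfolding B_def
      proof (intro mult_left_mono)
        have "real k * ln (16 * (real N * (real k + 1))) \<le> h * x"
        proof -
          have "real k * ln (16 * (real N * (real k + 1))) \<le> real k * x" using lnN by (intro mult_left_mono) auto
          also have "\<dots> \<le> h * x" using k x by (intro mult_right_mono) auto
          finally show ?thesis .
        qed
        moreover have "ln (1 / d) \<le> x" using ln_le_minus_one[of "1 / d"] d0 dx by simp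
        ultimately show "ln 4050 + 2 * L + real k * ln (16 * (real N * (real k + 1))) + 2 * ln (1 / d) \<le> 6 * (G * x)"
          using ln4050 L xG GGx by (simp add: mult.commute)
      qed simp
      have "(B + 1) / d = (B + 1) * (1 / d)" by simp
      also have "\<dots> \<le> (7 * real k * (G * x)) * x"
      proof (rule mult_mono)
        have "1 \<le> G * x" using GGx G by linarith
        then have "1 * 1 \<le> real k * (G * x)" using kh by (intro mult_mono) auto
        then show "B + 1 \<le> 7 * real k * (G * x)" using Bk by linarith
      qed (use dx d0 G x in auto)
      finally have *: "(B + 1) / d \<le> 7 * real k * (G * x) * x" .
      have "(B + 1) / d + 1 \<le> 8 * (real k * (G * x * x))"
      proof -
        have "1 \<le> G * x" using GGx G by linarith
        then have "1 * (1 * 1) \<le> real k * (G * x * x)" using kh x by (intro mult_mono) auto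
        then show ?thesis using * by (simp add: mult_ac)
      qed
      also have "\<dots> = real k * (8 * (h * x ^ 4))" by (simp add: G16 power2_eq_square power4_eq_xxxx mult_ac)
      also have "\<dots> \<le> real k * real k powr (1 + \<delta>)"
      proof (rule mult_left_mono)
        \<comment> \<open>The total cost is \<open>k\<close> times \<open>8 * h * x ^ 4\<close>,
          where \<open>h * x ^ 4\<close> is \<open>G powr (1 + 2 * \<epsilon>)\<close>. With
          \<open>\<delta> = 10 * \<epsilon>\<close> there is room for a further
          \<open>x ^ 4\<close>, which absorbs the numerical constants.\<close>
        have "G powr (1 + 6 * \<epsilon>) \<le> G powr ((1 - 2 * \<epsilon>) * (1 + \<delta>))"
        proof (rule powr_mono)
          have "\<epsilon> * \<epsilon> \<le> (1 / 10) * \<epsilon>" using \<epsilon> by (intro mult_right_mono) auto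
          moreover have "(1 - 2 * \<epsilon>) * (1 + \<delta>) = 1 + 8 * \<epsilon> - 20 * (\<epsilon> * \<epsilon>)"
            by (simp add: \<epsilon>_def field_simps)
          ultimately show "1 + 6 * \<epsilon> \<le> (1 - 2 * \<epsilon>) * (1 + \<delta>)" by linarith
        qed (use G in auto)
        also have "\<dots> = h powr (1 + \<delta>)" by (simp add: h_def powr_powr)
        finally have 1: "G powr (1 + 6 * \<epsilon>) \<le> h powr (1 + \<delta>)" .
        have "h powr (1 + \<delta>) = 2 powr (1 + \<delta>) * (h / 2) powr (1 + \<delta>)"
          using h2 by (simp flip: powr_mult)
        also have "\<dots> \<le> 4 * real k powr (1 + \<delta>)"
        proof (rule mult_mono)
          have "(2::real) powr (1 + \<delta>) \<le> 2 powr 2" using \<delta> by (intro powr_mono) auto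
          then show "(2::real) powr (1 + \<delta>) \<le> 4" by simp
          show "(h / 2) powr (1 + \<delta>) \<le> real k powr (1 + \<delta>)" using kh h2 \<delta> by (intro powr_mono2) auto
        qed auto
        finally have 2: "h powr (1 + \<delta>) \<le> 4 * real k powr (1 + \<delta>)" .
        have "G powr (1 + 6 * \<epsilon>) = G * x ^ 6"
          using G by (simp add: powr_add x_def powr_powr mult.commute flip: powr_numeral)
        also have "\<dots> = x ^ 4 * (h * x ^ 4)" by (simp add: G16 power2_eq_square power4_eq_xxxx eval_nat_numeral)
        also have "\<dots> \<ge> 32 * (h * x ^ 4)"
        proof (rule mult_right_mono)
          have "400 ^ 1 \<le> x ^ 1" using x by simp
          also have "x ^ 1 \<le> x ^ 4" using x by (intro power_increasing) auto
          finally show "32 \<le> x ^ 4" by simp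
        qed (use h2 in auto)
        finally show "8 * (h * x ^ 4) \<le> real k powr (1 + \<delta>)" using 1 2 by linarith
      qed simp
      also have "\<dots> = real k powr (2 + \<delta>)" using kh
        by (simp add: powr_mult_base)
      finally show "(real k * (ln 4050 + 2 * L + real k * ln (16 * (real N * (real k + 1))) + 2 * ln (1 / d)) + 1) / d + 1
          \<le> real k powr (2 + \<delta>)" by (simp add: B_def)
    qed (use kh N in auto)
  qed
qed

section \<open>The exponent\<close>

text \<open>The index \<open>j\<close> serves three ends: degrees go to infinity, the surplus over
  the exponent 2 goes to 0, and the radii covered exhaust the positive axis. The good scale may lie
  far out, but \<open>ball_max_slope\<close> transports its growth bound down to every
  \<open>r\<close> up to \<open>j\<close>.\<close>

lemma doubling_at_many_degrees:
  fixes f :: "complex ^ 'n \<Rightarrow> complex"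
  assumes f: "entire f" "\<not> polynomial_fun f"
  shows "\<exists>k N :: nat. k \<ge> j \<and> real N \<le> real k powr (2 + 1 / (real j + 1)) \<and>
    (\<forall>(p :: ('n + 1) cpoly) r. cpoly_degree p \<le> k \<longrightarrow> 0 < r \<longrightarrow> r \<le> real j \<longrightarrow>
      ball_max (\<lambda>z. cpoly_eval p (join_point z (f z))) (exp 1 * r) \<le>
      exp (real N) * ball_max (\<lambda>z. cpoly_eval p (join_point z (f z))) r)"
proof -
  define M where "M = ball_max f"
  note cont = entire_imp_continuous_on[OF f(1), of UNIV]
  define \<delta> :: real where "\<delta> = 1 / (real j + 1)"
  have \<delta>: "0 < \<delta>" "\<delta> \<le> 1" by (simp_all add: \<delta>_def)
  \<comment> \<open>Starting beyond \<open>1 + ln (real j + 1)\<close> puts the whole scale outside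
    the ball of radius \<open>exp 1 * r\<close> for each \<open>r\<close> up to
    \<open>j\<close>.\<close>
  obtain x1 where x1: "x1 \<ge> 1 + ln (real j + 1)" "M (exp x1) \<ge> 1"
    using large_increment[OF f] unfolding M_def by blast
  have M1: "M (exp x) \<ge> 1" if "x \<ge> x1" for x
    using ball_max_mono[OF cont, of "exp x1" "exp x"] x1 that by (simp add: M_def)
  define \<phi> where "\<phi> = (\<lambda>x. ln (M (exp x)))"
  have mono: "\<phi> x \<le> \<phi> x'" if "x1 \<le> x" "x \<le> x'" for x x'
  proof -
    have "M (exp x) \<le> M (exp x')" unfolding M_def using that by (intro ball_max_mono cont) auto
    then show ?thesis using M1[of x] M1[of x'] that unfolding \<phi>_def by (subst ln_le_cancel_iff) auto
  qed
  have \<phi>_diff: "\<phi> x' - \<phi> x = ln (M (exp x') / M (exp x))" if "x1 \<le> x" "x1 \<le> x'" for x x'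
    using M1[of x] M1[of x'] that by (simp add: \<phi>_def ln_div)
  have incr: "\<exists>y\<ge>x1. \<phi> (y + 1) - \<phi> y \<ge> Y" for Y
  proof -
    obtain y where y: "y \<ge> x1" "M (exp y) \<ge> 1" "M (exp (y + 1)) \<ge> exp Y * M (exp y)"
      using large_increment[OF f, of x1 Y] unfolding M_def by blast
    then have "exp Y \<le> M (exp (y + 1)) / M (exp y)" by (simp add: field_simps)
    then have "Y \<le> ln (M (exp (y + 1)) / M (exp y))" using y by (subst ln_ge_iff) (auto intro: order_less_le_trans[OF exp_gt_zero])
    then show ?thesis using y \<phi>_diff[of y "y + 1"] by auto
  qed
  obtain G0 where G0: "\<And>G. G \<ge> G0 \<Longrightarrow> \<exists>k N :: nat. k \<ge> j \<and> N \<ge> 1 \<and>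
    (\<forall>d L. G powr (- (\<delta> / 10)) \<le> d \<longrightarrow> d \<le> 1 \<longrightarrow> 0 < d \<longrightarrow> L \<le> G powr (1 + \<delta> / 10) \<longrightarrow>
      G - (real k + 1) * ln 2 \<ge> ln 4 \<and>
      12 / d * (real N * (ln (5 * (real N * (real k + 1))) + 4 * real k) + 4 / d * (ln 5 + L))
        < real N * (G - (real k + 1) * ln 2) \<and>
      (real k * (ln 4050 + 2 * L + real k * ln (16 * (real N * (real k + 1))) + 2 * ln (1 / d)) + 1) / d + 1
        \<le> real k powr (2 + \<delta>))"
    using doubling_parameters[OF \<delta>, of j] by blast
  obtain y d where yd: "y \<ge> x1" "0 < d" "d \<le> 1" "\<phi> (y + d) - \<phi> y \<ge> G0"
    "d \<ge> (\<phi> (y + d) - \<phi> y) powr (- (\<delta> / 10))" "\<phi> (y + 6 * d) - \<phi> y \<le> (\<phi> (y + d) - \<phi> y) powr (1 + \<delta> / 10)"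
    using exists_regular_growth[of x1 \<phi> "\<delta> / 10" G0] mono incr \<delta> by auto
  define G where "G = \<phi> (y + d) - \<phi> y"
  define L where "L = \<phi> (y + 6 * d) - \<phi> y"
  obtain k N where kN: "k \<ge> j" "N \<ge> 1" "G - (real k + 1) * ln 2 \<ge> ln 4"
    "12 / d * (real N * (ln (5 * (real N * (real k + 1))) + 4 * real k) + 4 / d * (ln 5 + L))
        < real N * (G - (real k + 1) * ln 2)"
    "(real k * (ln 4050 + 2 * L + real k * ln (16 * (real N * (real k + 1))) + 2 * ln (1 / d)) + 1) / d + 1
        \<le> real k powr (2 + \<delta>)"
    using G0[of G] yd unfolding G_def L_def by blast
  define B where "B = real k * (ln 4050 + 2 * L + real k * ln (16 * (real N * (real k + 1))) + 2 * ln (1 / d))"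
  have L0: "L \<ge> 0" unfolding L_def using mono[of y "y + 6 * d"] yd by simp
  have NN: "1 * 1 \<le> real N * (real k + 1)" using kN by (intro mult_mono) auto
  have B0: "B \<ge> 0" unfolding B_def using L0 NN yd by (intro mult_nonneg_nonneg add_nonneg_nonneg) auto
  \<comment> \<open>A factor \<open>exp B\<close> over a logarithmic step \<open>d\<close> is slope
    \<open>B / d\<close>; the added 1 makes the comparison in \<open>gr\<close> strict.\<close>
  define E where "E = nat \<lceil>(B + 1) / d\<rceil>"
  have "(B + 1) / d \<ge> 0" using B0 yd by simp
  then have E: "(B + 1) / d \<le> real E" "real E \<le> (B + 1) / d + 1" by (auto simp: E_def of_nat_ceiling)
  show ?thesis
  proof (rule exI[of _ k], rule exI[of _ E], intro conjI allI impI)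
    show "real E \<le> real k powr (2 + 1 / (real j + 1))" using E kN(5) by (simp add: B_def \<delta>_def)
    fix p :: "('n + 1) cpoly" and r :: real
    assume p: "cpoly_degree p \<le> k" and r: "0 < r" "r \<le> real j"
    define P where "P = (\<lambda>z. cpoly_eval p (join_point z (f z)))"
    have contP: "continuous_on UNIV P" unfolding P_def by (rule continuous_on_cpoly_eval_join_point[OF cont])
    have holP: "(\<lambda>x. P (x *s v)) holomorphic_on UNIV" for v
      unfolding P_def
      using holomorphic_cpoly_eval_join_point[OF entire_imp_holomorphic_line[OF f(1), of 0 v]] by simp
    have "ball_max P (exp (y + 6 * d)) \<le>
       (4050 * exp (2 * L) * (16 * (real N * (real k + 1))) ^ k / d\<^sup>2) ^ k * ball_max P (exp (y + 5 * d))"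
      unfolding P_def
    proof (rule doubling_step[OF f(1) p yd(2,3)])
      show "0 < ball_max f (exp y)" using M1[of y] yd by (simp add: M_def)
      show "L = ln (ball_max f (exp (y + 6 * d)) / ball_max f (exp y))"
        using \<phi>_diff[of y "y + 6 * d"] yd by (simp add: L_def M_def)
      show "G - (real k + 1) * ln 2 = ln (ball_max f (exp (y + d)) / ball_max f (exp y)) - (real k + 1) * ln 2"
        using \<phi>_diff[of y "y + d"] yd by (simp add: G_def M_def)
    qed (use kN in auto)
    also have "(4050 * exp (2 * L) * (16 * (real N * (real k + 1))) ^ k / d\<^sup>2) ^ k = exp B"
    proof -
      have "4050 * exp (2 * L) * (16 * (real N * (real k + 1))) ^ k / d\<^sup>2 =
          exp (ln 4050 + 2 * L + real k * ln (16 * (real N * (real k + 1))) + 2 * ln (1 / d))"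
      proof -
        have "exp (2 * ln (1 / d)) = (exp (ln (1 / d)))\<^sup>2" by (simp only: exp_double)
        also have "\<dots> = 1 / d\<^sup>2" using yd by (simp only: exp_ln zero_less_divide_1_iff power_divide power_one)
        finally have 1: "exp (2 * ln (1 / d)) = 1 / d\<^sup>2" .
        have 2: "exp (real k * ln (16 * (real N * (real k + 1)))) = (16 * (real N * (real k + 1))) ^ k"
          unfolding exp_of_nat_mult using NN by (subst exp_ln) auto
        show ?thesis unfolding exp_add 1 2 by simp
      qed
      then show ?thesis unfolding B_def by (simp only: exp_of_nat_mult)
    qed
    finally have step: "ball_max P (exp (y + 6 * d)) \<le> exp B * ball_max P (exp (y + 5 * d))" .
    have gr: "ball_max P (exp (y + 6 * d)) < (exp (y + 6 * d) / exp (y + 5 * d)) ^ E * ball_max P (exp (y + 5 * d))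
        \<or> ball_max P (exp (y + 6 * d)) \<le> 0"
    proof (cases "ball_max P (exp (y + 5 * d)) = 0")
      case True
      then show ?thesis using step by simp
    next
      case False
      then have pos: "ball_max P (exp (y + 5 * d)) > 0"
        using ball_max_nonneg[OF contP, of "exp (y + 5 * d)"] by simp
      have "B < real E * d" using E yd by (simp add: divide_le_eq)
      then have "exp B < exp d ^ E" by (simp flip: exp_of_nat_mult)
      moreover have "exp (y + 6 * d) / exp (y + 5 * d) = exp d" by (simp flip: exp_diff)
      ultimately show ?thesis using step pos by (smt (verit) mult_strict_right_mono)
    qed
    have "ball_max P (exp 1 * r) \<le> (exp 1 * r / r) ^ E * ball_max P r"
    proof (rule ball_max_slope[OF contP holP r(1) _ _ _ gr])
      show "r < exp 1 * r" using r by simp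
      have "exp 1 * r \<le> exp 1 * (real j + 1)" using r by simp
      also have "\<dots> = exp (1 + ln (real j + 1))" by (simp add: exp_add)
      also have "\<dots> \<le> exp (y + 5 * d)" using x1 yd by simp
      finally show "exp 1 * r \<le> exp (y + 5 * d)" .
    qed (use yd in auto)
    then show "ball_max (\<lambda>z. cpoly_eval p (join_point z (f z))) (exp 1 * r) \<le>
      exp (real E) * ball_max (\<lambda>z. cpoly_eval p (join_point z (f z))) r"
      using r exp_of_nat_mult[of E "1 :: real"] unfolding P_def by simp
  qed (use kN in auto)
qed

theorem theorem1p5:
  fixes f :: "complex ^ 'n \<Rightarrow> complex"
  assumes "entire f"
    and "\<not> polynomial_fun f"
  shows "\<exists>\<mu> :: nat \<Rightarrow> real. (\<forall>k. 0 \<le> \<mu> k) \<and>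
           admits_bernstein (\<lambda>z. (vec (f z) :: complex ^ 1)) \<mu> \<and>
           ereal (1 + 1 / real CARD('n)) \<le> liminf (\<lambda>k. ereal (ln (\<mu> k) / ln (real k))) \<and>
           liminf (\<lambda>k. ereal (ln (\<mu> k) / ln (real k))) \<le> 2"
proof -
  define Dbl where "Dbl = (\<lambda>K r E. \<forall>p :: ('n + 1) cpoly. cpoly_degree p \<le> K \<longrightarrow>
      graph_max (\<lambda>z. vec (f z) :: complex ^ 1) p (exp 1 * r) \<le>
      exp (real E) * graph_max (\<lambda>z. vec (f z) :: complex ^ 1) p r)"
  have "\<exists>k N. k \<ge> j \<and> real N \<le> real k powr (2 + 1 / (real j + 1)) \<and> (\<forall>r. 0 < r \<longrightarrow> r \<le> real j \<longrightarrow> Dbl k r N)" for j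
    using doubling_at_many_degrees[OF assms, of j] unfolding Dbl_def graph_max_vec by blast
  then obtain K N where K: "\<And>j. K j \<ge> j" and N: "\<And>j. real (N j) \<le> real (K j) powr (2 + 1 / (real j + 1))"
    and dbl: "\<And>j r. 0 < r \<Longrightarrow> r \<le> real j \<Longrightarrow> Dbl (K j) r (N j)"
    by metis
  have fin: "finite {j. K j = k}" for k by (rule finite_subset[of _ "{..k}"]) (use K in auto)
  \<comment> \<open>Several indices may share a degree \<open>K j\<close>; the largest one has the
    best exponent and the largest range of radii. A degree outside the range of \<open>K\<close>
    uses index \<open>k\<close>, whose degree \<open>K k\<close> is at least
    \<open>k\<close>.\<close>
  define \<iota> where "\<iota> = (\<lambda>k. if {j. K j = k} = {} then k else Max {j. K j = k})"
  have \<iota>_K: "K (\<iota> k) = k" if "{j. K j = k} \<noteq> {}" for k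
    using Max_in[OF fin that] that by (simp add: \<iota>_def)
  have K\<iota>: "k \<le> K (\<iota> k)" for k
    using \<iota>_K[of k] K[of k] by (cases "{j. K j = k} = {}") (auto simp: \<iota>_def)
  have \<iota>_ge: "j \<le> \<iota> (K j)" for j
    unfolding \<iota>_def using fin by (auto intro: Max_ge)
  \<comment> \<open>The square secures the lower bound for the liminf. At degrees outside the range
    of \<open>K\<close> the value may be huge, which does not affect a liminf bounded along the
    range of \<open>K\<close>.\<close>
  define \<mu> where "\<mu> = (\<lambda>k. max 1 (max (real k ^ 2) (real (N (\<iota> k)))))"
  have \<mu>1: "\<mu> k \<ge> 1" for k by (simp add: \<mu>_def)
  have dblD: "graph_max (\<lambda>z. vec (f z) :: complex ^ 1) p (exp 1 * r) \<le>
      exp (real (N j)) * graph_max (\<lambda>z. vec (f z) :: complex ^ 1) p r"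
    if "0 < r" "r \<le> real j" "cpoly_degree p \<le> K j" for p :: "('n + 1) cpoly" and r j
    using dbl[OF that(1,2)] that(3) unfolding Dbl_def by blast
  have "admits_bernstein (\<lambda>z. vec (f z) :: complex ^ 1) \<mu>"
    unfolding admits_bernstein_def
  proof (intro allI impI)
    fix r :: real assume r: "r > 0"
    define j0 where "j0 = nat \<lceil>r\<rceil>"
    have j0: "r \<le> real j0" by (simp add: j0_def of_nat_ceiling)
    \<comment> \<open>The degrees whose index does not yet cover the radius \<open>r\<close>. They
      are finitely many, so the constant depending on \<open>r\<close> absorbs them.\<close>
    define A where "A = {k. \<iota> k < j0}"
    have "A \<subseteq> K ` {..<j0} \<union> {..<j0}"
    proof
      fix k assume k: "k \<in> A"
      show "k \<in> K ` {..<j0} \<union> {..<j0}"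
      proof (cases "{j. K j = k} = {}")
        case True
        then show ?thesis using k by (simp add: A_def \<iota>_def)
      next
        case False
        then have "k = K (\<iota> k)" using \<iota>_K by simp
        then show ?thesis using k unfolding A_def by blast
      qed
    qed
    then have finA: "finite A" by (rule finite_subset) auto
    \<comment> \<open>For an uncovered degree \<open>k\<close>, index \<open>max j0 k\<close> covers
      both the radius \<open>r\<close> and the degree.\<close>
    define D where "D = 1 + (\<Sum>k\<in>A. real (N (max j0 k)))"
    have D: "D \<ge> 1" "\<And>k. k \<in> A \<Longrightarrow> real (N (max j0 k)) \<le> D"
    proof -
      show "D \<ge> 1" by (simp add: D_def sum_nonneg)
      show "real (N (max j0 k)) \<le> D" if "k \<in> A" for k
        using member_le_sum[OF that, of "\<lambda>k. real (N (max j0 k))"] finA by (simp add: D_def)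
    qed
    have "graph_max (\<lambda>z. vec (f z) :: complex ^ 1) p (exp 1 * r) \<le>
        exp D powr \<mu> (cpoly_degree p) * graph_max (\<lambda>z. vec (f z) :: complex ^ 1) p r" for p :: "('n + 1) cpoly"
    proof -
      define k where "k = cpoly_degree p"
      have nonneg: "graph_max (\<lambda>z. vec (f z) :: complex ^ 1) p r \<ge> 0"
        unfolding graph_max_vec
        by (intro ball_max_nonneg continuous_on_cpoly_eval_join_point entire_imp_continuous_on assms) (use r in auto)
      have "\<exists>j. r \<le> real j \<and> k \<le> K j \<and> real (N j) \<le> D * \<mu> k"
      proof (cases "k \<in> A")
        case True
        have "k \<le> K (max j0 k)" using K[of "max j0 k"] by simp
        moreover have "D * 1 \<le> D * \<mu> k" using D \<mu>1 by (intro mult_left_mono) auto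
        then have "real (N (max j0 k)) \<le> D * \<mu> k" using D(2)[OF True] by simp
        moreover have "r \<le> real (max j0 k)" using j0 by simp
        ultimately show ?thesis by blast
      next
        case False
        have "r \<le> real (\<iota> k)" using False j0 by (simp add: A_def)
        moreover have "1 * \<mu> k \<le> D * \<mu> k" using D \<mu>1[of k] by (intro mult_right_mono) auto
        then have "real (N (\<iota> k)) \<le> D * \<mu> k" by (simp add: \<mu>_def)
        ultimately show ?thesis using K\<iota> by blast
      qed
      then obtain j where j: "r \<le> real j" "k \<le> K j" "real (N j) \<le> D * \<mu> k" by blast
      have "exp (real (N j)) \<le> exp D powr \<mu> k" using j(3) by (simp add: powr_def mult.commute)
      then have "exp (real (N j)) * graph_max (\<lambda>z. vec (f z) :: complex ^ 1) p r \<le>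
          exp D powr \<mu> k * graph_max (\<lambda>z. vec (f z) :: complex ^ 1) p r"
        by (rule mult_right_mono[OF _ nonneg])
      then show ?thesis
        using order_trans[OF dblD[OF r j(1)], of p] j(2) unfolding k_def by blast
    qed
    then show "\<exists>C\<ge>0. \<forall>p :: ('n + 1) cpoly. graph_max (\<lambda>z. vec (f z) :: complex ^ 1) p (exp 1 * r) \<le>
        C powr \<mu> (cpoly_degree p) * graph_max (\<lambda>z. vec (f z) :: complex ^ 1) p r"
      by (intro exI[of _ "exp D"]) auto
  qed
  moreover have "ereal (1 + 1 / real CARD('n)) \<le> liminf (\<lambda>k. ereal (ln (\<mu> k) / ln (real k)))"
  proof (rule Liminf_bounded)
    \<comment> \<open>There is at least one variable, so the asserted lower bound is at most 2 and
      follows from the square in \<open>\<mu>\<close>.\<close>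
    have n: "1 + 1 / real CARD('n) \<le> 2" using zero_less_card_finite[where 'a = 'n]
      by (simp add: field_simps)
    show "\<forall>\<^sub>F k in sequentially. ereal (1 + 1 / real CARD('n)) \<le> ereal (ln (\<mu> k) / ln (real k))"
      using eventually_ge_at_top[of 2]
    proof eventually_elim
      case (elim k)
      have "ln (real k ^ 2) \<le> ln (\<mu> k)" using elim by (subst ln_le_cancel_iff) (auto simp: \<mu>_def)
      then have "2 \<le> ln (\<mu> k) / ln (real k)" using elim by (simp add: ln_realpow field_simps)
      then have "1 + 1 / real CARD('n) \<le> ln (\<mu> k) / ln (real k)" by (rule order_trans[OF n])
      then show ?case by (rule ereal_less_eq(3)[THEN iffD2])
    qed
  qed
  moreover have "liminf (\<lambda>k. ereal (ln (\<mu> k) / ln (real k))) \<le> 2"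
  proof (rule ccontr)
    assume "\<not> ?thesis"
    then have "ereal 2 < liminf (\<lambda>k. ereal (ln (\<mu> k) / ln (real k)))" by simp
    from ereal_dense2[OF this]
    obtain c where c: "ereal 2 < ereal c" "ereal c < liminf (\<lambda>k. ereal (ln (\<mu> k) / ln (real k)))"
      by blast
    then have "\<forall>\<^sub>F k in sequentially. ereal c < ereal (ln (\<mu> k) / ln (real k))"
      by (intro less_LiminfD)
    then obtain k0 where k0: "\<And>k. k \<ge> k0 \<Longrightarrow> c < ln (\<mu> k) / ln (real k)"
      unfolding eventually_sequentially by auto
    have c2: "c > 2" using c(1) by (rule less_ereal.simps(1)[THEN iffD1])
    obtain m :: nat where m: "1 / (c - 2) < real m" using reals_Archimedean2 by blast
    \<comment> \<open>Beyond \<open>m\<close> the surplus \<open>1 / (\<iota> k + 1)\<close> is at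
      most \<open>c - 2\<close>; beyond \<open>k0\<close> the assumed lower bound applies, and from
      2 on \<open>ln (real k)\<close> is positive.\<close>
    define j where "j = max (max k0 2) m"
    define k where "k = K j"
    have kj: "k \<ge> k0" "k \<ge> 2" using K[of j] by (auto simp: k_def j_def)
    have "real m \<le> real (\<iota> k) + 1" using \<iota>_ge[of j] by (simp add: k_def j_def)
    then have "1 / (c - 2) \<le> real (\<iota> k) + 1" using m by linarith
    then have ic: "1 / (real (\<iota> k) + 1) \<le> c - 2" using c2 by (simp add: field_simps)
    have "K (\<iota> k) = k" by (rule \<iota>_K) (auto simp: k_def)
    then have "real (N (\<iota> k)) \<le> real k powr (2 + 1 / (real (\<iota> k) + 1))" using N[of "\<iota> k"] by simp
    also have "\<dots> \<le> real k powr c" using ic kj by (intro powr_mono) auto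
    finally have "real (N (\<iota> k)) \<le> real k powr c" .
    moreover have "real k ^ 2 \<le> real k powr c"
    proof -
      have "real k ^ 2 = real k powr 2" using kj by (simp add: powr_numeral)
      also have "\<dots> \<le> real k powr c" using c2 kj by (intro powr_mono) auto
      finally show ?thesis .
    qed
    moreover have "1 \<le> real k powr c" using kj c2 by (intro ge_one_powr_ge_zero) auto
    ultimately have "\<mu> k \<le> real k powr c" by (simp add: \<mu>_def)
    then have "ln (\<mu> k) \<le> ln (real k powr c)" using \<mu>1[of k] kj by (subst ln_le_cancel_iff) auto
    then have "ln (\<mu> k) \<le> c * ln (real k)" by simp
    then have "ln (\<mu> k) / ln (real k) \<le> c" using kj by (simp add: divide_le_eq)
    then show False using k0[OF kj(1)] by simp
  qed
  moreover have "\<forall>k. 0 \<le> \<mu> k" using order_trans[OF zero_le_one \<mu>1] by blast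
  ultimately show ?thesis by blast
qed

end
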